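(* Let $d\ge1$ and $\kappa\ge1$ be integers. Then $\boldsymbol{\Theta}_{m,\kappa}(\Delta)\subset\boldsymbol{\Theta}_{m,\alpha\kappa}(\Delta)\subset\boldsymbol{\Theta}_{\alpha\kappa}(\Delta)$ for all $m\in\mathbb{N}$ and all $\alpha\in\mathbb{N}^*$.
   Context: $\mathbb{N}=\{0,1,2,\dots\}$, $\mathbb{N}^*=\{1,2,\dots\}$. On $\mathscr{H}=\ell^2(\mathbb{Z}^d)$ let $(S_i^{\pm1}u)(n)=u(n_1,\dots,n_i\mp1,\dots,n_d)$, $\Delta=\sum_{i=1}^d\frac12(S_i+S_i^{*})$ (so $\sigma(\Delta)=[-d,d]$), and $(N_iu)(n)=n_iu(n)$. For $j,\kappa\in\mathbb{N}^*$ let $A_i(j,\kappa)$ be the closure of the operator $\frac{1}{4\mathrm{i}}\left[(S_i^{j\kappa}-S_i^{-j\kappa})N_i+N_i(S_i^{j\kappa}-S_i^{-j\kappa})\right]$ defined on compactly supported sequences, and $A_{j\kappa}=\sum_{i=1}^dA_i(j,\kappa)$ (self-adjoint). The conjugate operators considered are the self-adjoint linear combinations (finite or infinite) $\mathbb{A}=\sum_{j\ge1}\rho_{j\kappa}A_{j\kappa}$, $\rho_{j\kappa}\in\mathbb{R}$; $[\Delta,\mathrm{i}\mathbb{A}]_\circ$ is the bounded extension to $\mathscr{H}$ of the commutator initially defined on compactly supported sequences. $\boldsymbol{\mu}_\kappa(\Delta)$ is the set of $E\in\sigma(\Delta)$ for which there exist such an $\mathbb{A}$, an open interval $I\ni E$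 and $\gamma>0$ with $1_I(\Delta)[\Delta,\mathrm{i}\mathbb{A}]_\circ1_I(\Delta)\ge\gamma1_I(\Delta)$ ($1_I(\Delta)$ is the spectral projection). $\boldsymbol{\Theta}_\kappa(\Delta)=\sigma(\Delta)\setminus\boldsymbol{\mu}_\kappa(\Delta)$. Let $U_n$ be the Chebyshev polynomial of the second kind of degree $n$. For $\vec{x}=(x_1,\dots,x_d)\in[-1,1]^d$ let $g_{j\kappa}(\vec{x})=\sum_{i=1}^d(1-x_i^2)U_{j\kappa-1}(x_i)$, and for $E\in\sigma(\Delta)$ let $S_E=\{\vec{x}\in[-1,1]^d: x_1+\dots+x_d=E\}$. $E\in\boldsymbol{\Theta}_{0,\kappa}(\Delta)$ iff there is $\vec{x}\in S_E$ with $g_{j\kappa}(\vec{x})=0$ for all $j\in\mathbb{N}^*$. For $m\in\mathbb{N}^*$, $E\in\boldsymbol{\Theta}_{m,\kappa}(\Delta)$ iff there exist $\vec{x}_0,\dots,\vec{x}_m\in S_E$ and real numbers $\omega_0,\dots,\omega_{m-1}\le0$ such that $g_{j\kappa}(\vec{x}_m)=\sum_{q=0}^{m-1}\omega_q\,g_{j\kappa}(\vec{x}_q)$ for all $j\in\mathbb{N}^*$. The sets with $\alpha\kappa$ in place of $\kappa$ are defined by replacing $\kappa$ by $\alpha\kappa$ throughout. *)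

theory Defs
  imports "HOL-Analysis.Analysis" "HOL-Computational_Algebra.Polynomial"
begin

section \<open>The complex Hilbert space of square-summable families\<close>

lemma ell2_summable_mult:
  fixes f g :: "'a \<Rightarrow> complex"
  assumes f: "(\<lambda>n. (cmod (f n))\<^sup>2) summable_on UNIV"
    and g: "(\<lambda>n. (cmod (g n))\<^sup>2) summable_on UNIV"
  shows "(\<lambda>n. cnj (f n) * g n) summable_on UNIV"
proof -
  have s: "(\<lambda>n. (cmod (f n))\<^sup>2 + (cmod (g n))\<^sup>2) summable_on UNIV"
    using f g by (rule summable_on_add)
  have "(\<lambda>n. norm (cnj (f n) * g n)) summable_on UNIV"
  proof (rule summable_on_comparison_test[OF s])
    fix n
    have "0 \<le> (cmod (f n) - cmod (g n))\<^sup>2" "0 \<le> (cmod (f n) + cmod (g n))\<^sup>2" by simp_all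
    hence "2 * (cmod (f n) * cmod (g n)) \<le> (cmod (f n))\<^sup>2 + (cmod (g n))\<^sup>2"
      by (simp add: power2_diff)
    moreover have "0 \<le> cmod (f n) * cmod (g n)" by simp
    ultimately show "norm (cnj (f n) * g n) \<le> (cmod (f n))\<^sup>2 + (cmod (g n))\<^sup>2"
      unfolding norm_mult complex_mod_cnj by linarith
  qed auto
  thus ?thesis by (rule abs_summable_summable)
qed

lemma ell2_summable_add:
  fixes f g :: "'a \<Rightarrow> complex"
  assumes f: "(\<lambda>n. (cmod (f n))\<^sup>2) summable_on UNIV"
    and g: "(\<lambda>n. (cmod (g n))\<^sup>2) summable_on UNIV"
  shows "(\<lambda>n. (cmod (f n + g n))\<^sup>2) summable_on UNIV"
proof (rule summable_on_comparison_test)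
  show "(\<lambda>n. 2 * ((cmod (f n))\<^sup>2 + (cmod (g n))\<^sup>2)) summable_on UNIV"
    by (intro summable_on_cmult_right summable_on_add f g)
  fix n
  have "(cmod (f n + g n))\<^sup>2 \<le> (cmod (f n) + cmod (g n))\<^sup>2"
    by (simp add: norm_triangle_ineq power_mono)
  moreover have "0 \<le> (cmod (f n) - cmod (g n))\<^sup>2" by simp
  ultimately show "(cmod (f n + g n))\<^sup>2 \<le> 2 * ((cmod (f n))\<^sup>2 + (cmod (g n))\<^sup>2)"
    by (simp add: power2_sum power2_diff)
qed simp

lemma ell2_summable_scale:
  fixes f :: "'a \<Rightarrow> complex"
  assumes "(\<lambda>n. (cmod (f n))\<^sup>2) summable_on UNIV"
  shows "(\<lambda>n. (cmod (c * f n))\<^sup>2) summable_on UNIV"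
  using summable_on_cmult_right[OF assms, of "(cmod c)\<^sup>2"]
  by (simp add: norm_mult power_mult_distrib)

typedef 'a ell2 = "{f :: 'a \<Rightarrow> complex. (\<lambda>n. (cmod (f n))\<^sup>2) summable_on UNIV}"
  morphisms seq Abs_ell2
  by (rule exI[of _ "\<lambda>_. 0"]) simp

setup_lifting type_definition_ell2

lift_definition scaleC :: "complex \<Rightarrow> 'a ell2 \<Rightarrow> 'a ell2" (infixr "*\<^sub>C" 75)
  is "\<lambda>c f n. c * f n"
  by (rule ell2_summable_scale)

text \<open>The inner product is antilinear in its first argument.\<close>

lift_definition cinner :: "'a ell2 \<Rightarrow> 'a ell2 \<Rightarrow> complex"
  is "\<lambda>f g. \<Sum>\<^sub>\<infinity>n. cnj (f n) * g n" .

instantiation ell2 :: (type) real_inner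
begin

lift_definition zero_ell2 :: "'a ell2" is "\<lambda>_. 0" by simp

lift_definition plus_ell2 :: "'a ell2 \<Rightarrow> 'a ell2 \<Rightarrow> 'a ell2" is "\<lambda>f g n. f n + g n"
  by (rule ell2_summable_add)

lift_definition uminus_ell2 :: "'a ell2 \<Rightarrow> 'a ell2" is "\<lambda>f n. - f n" by simp

lift_definition minus_ell2 :: "'a ell2 \<Rightarrow> 'a ell2 \<Rightarrow> 'a ell2" is "\<lambda>f g n. f n - g n"
  subgoal for f g using ell2_summable_add[of f "\<lambda>n. - g n"] by simp
  done

lift_definition scaleR_ell2 :: "real \<Rightarrow> 'a ell2 \<Rightarrow> 'a ell2" is "\<lambda>r f n. of_real r * f n"
  by (rule ell2_summable_scale)

definition inner_ell2 :: "'a ell2 \<Rightarrow> 'a ell2 \<Rightarrow> real"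
  where "inner_ell2 u v = Re (cinner u v)"

definition norm_ell2 :: "'a ell2 \<Rightarrow> real"
  where "norm_ell2 u = sqrt (inner u u)"

definition dist_ell2 :: "'a ell2 \<Rightarrow> 'a ell2 \<Rightarrow> real"
  where "dist_ell2 u v = norm (u - v)"

definition sgn_ell2 :: "'a ell2 \<Rightarrow> 'a ell2"
  where "sgn_ell2 u = inverse (norm u) *\<^sub>R u"

definition uniformity_ell2 :: "('a ell2 \<times> 'a ell2) filter"
  where "uniformity_ell2 = (INF e\<in>{0<..}. principal {(u, v). dist u v < e})"

definition open_ell2 :: "'a ell2 set \<Rightarrow> bool"
  where "open_ell2 U \<longleftrightarrow> (\<forall>u\<in>U. \<forall>\<^sub>F (u', v) in uniformity. u' = u \<longrightarrow> v \<in> U)"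

instance
proof
  fix u v w :: "'a ell2" and r s :: real
  show "u + v + w = u + (v + w)" by transfer (simp add: add.assoc)
  show "u + v = v + u" by transfer (simp add: add.commute)
  show "0 + u = u" by transfer simp
  show "- u + u = 0" by transfer simp
  show "u - v = u + - v" by transfer simp
  show "r *\<^sub>R (u + v) = r *\<^sub>R u + r *\<^sub>R v" by transfer (simp add: algebra_simps)
  show "(r + s) *\<^sub>R u = r *\<^sub>R u + s *\<^sub>R u" by transfer (simp add: algebra_simps)
  show "r *\<^sub>R s *\<^sub>R u = (r * s) *\<^sub>R u" by transfer (simp add: mult.assoc)
  show "1 *\<^sub>R u = u" by transfer simp
  show "dist u v = norm (u - v)" by (rule dist_ell2_def)
  show "sgn u = inverse (norm u) *\<^sub>R u" by (rule sgn_ell2_def)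
  show "(uniformity :: ('a ell2 \<times> 'a ell2) filter)
      = (INF e\<in>{0<..}. principal {(u, v). dist u v < e})" by (rule uniformity_ell2_def)
  show "open U \<longleftrightarrow> (\<forall>u\<in>U. \<forall>\<^sub>F (u', v) in uniformity. u' = u \<longrightarrow> v \<in> U)"
    for U :: "'a ell2 set" by (rule open_ell2_def)
  show "norm u = sqrt (inner u u)" by (rule norm_ell2_def)
  have "cinner v u = cnj (cinner u v)"
    by transfer (simp flip: infsum_cnj add: mult.commute)
  thus "inner u v = inner v u" by (simp add: inner_ell2_def)
  have "cinner (u + v) w = cinner u w + cinner v w"
    by transfer (simp add: distrib_right infsum_add ell2_summable_mult)
  thus "inner (u + v) w = inner u w + inner v w" by (simp add: inner_ell2_def)
  have "cinner (r *\<^sub>R u) v = of_real r * cinner u v"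
    by transfer (simp add: mult.assoc infsum_cmult_right ell2_summable_mult)
  thus "inner (r *\<^sub>R u) v = r * inner u v" by (simp add: inner_ell2_def)
  have uu: "inner u u = (\<Sum>\<^sub>\<infinity>n. (cmod (seq u n))\<^sup>2)"
  proof -
    have "cinner u u = (\<Sum>\<^sub>\<infinity>n. of_real ((cmod (seq u n))\<^sup>2))"
      unfolding cinner.rep_eq
      by (rule infsum_cong) (metis complex_norm_square mult.commute)
    also have "\<dots> = of_real (\<Sum>\<^sub>\<infinity>n. (cmod (seq u n))\<^sup>2)"
      using seq[of u] by (intro infsumI has_sum_of_real) (simp add: has_sum_infsum)
    finally show ?thesis by (simp add: inner_ell2_def)
  qed
  show "0 \<le> inner u u" unfolding uu by (rule infsum_nonneg) simp
  show "inner u u = 0 \<longleftrightarrow> u = 0"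
  proof
    assume "inner u u = 0"
    hence "(\<Sum>\<^sub>\<infinity>n. (cmod (seq u n))\<^sup>2) = 0" using uu by simp
    hence "(cmod (seq u n))\<^sup>2 = 0" for n
      using nonneg_infsum_le_0D[of "\<lambda>n. (cmod (seq u n))\<^sup>2" UNIV n] seq[of u] by simp
    thus "u = 0" by (simp add: seq_inject[symmetric] zero_ell2.rep_eq fun_eq_iff)
  next
    assume "u = 0"
    thus "inner u u = 0" unfolding uu by (simp add: zero_ell2.rep_eq)
  qed
qed

end


section \<open>Bounded operators and the spectral theorem vocabulary\<close>

definition bounded_op :: "('a ell2 \<Rightarrow> 'a ell2) \<Rightarrow> bool"
  where "bounded_op T \<longleftrightarrow> bounded_linear T \<and> (\<forall>c u. T (c *\<^sub>C u) = c *\<^sub>C T u)"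

definition spectrum :: "('a ell2 \<Rightarrow> 'a ell2) \<Rightarrow> complex set"
  where "spectrum T = {z. \<not> (\<exists>R. bounded_op R \<and>
    (\<forall>u. R (T u - z *\<^sub>C u) = u) \<and> (\<forall>u. T (R u) - z *\<^sub>C R u = u))}"

definition op_le :: "('a ell2 \<Rightarrow> 'a ell2) \<Rightarrow> ('a ell2 \<Rightarrow> 'a ell2) \<Rightarrow> bool"
  where "op_le S T \<longleftrightarrow> (\<forall>u. cinner u (T u - S u) \<in> \<real>\<^sub>\<ge>\<^sub>0)"

definition orth_projection :: "('a ell2 \<Rightarrow> 'a ell2) \<Rightarrow> bool"
  where "orth_projection P \<longleftrightarrow> bounded_op P \<and> (\<forall>u. P (P u) = P u) \<and>
    (\<forall>u v. cinner (P u) v = cinner u (P v))"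

definition projection_valued_measure :: "(real set \<Rightarrow> 'a ell2 \<Rightarrow> 'a ell2) \<Rightarrow> bool"
  where "projection_valued_measure Q \<longleftrightarrow>
    (\<forall>X\<in>sets borel. orth_projection (Q X)) \<and>
    (\<forall>u. Q UNIV u = u) \<and>
    (\<forall>X\<in>sets borel. \<forall>Y\<in>sets borel. \<forall>u. Q (X \<inter> Y) u = Q X (Q Y u)) \<and>
    (\<forall>F :: nat \<Rightarrow> real set. range F \<subseteq> sets borel \<longrightarrow> disjoint_family F \<longrightarrow>
      (\<forall>u. (\<lambda>n. Q (F n) u) sums Q (\<Union>n. F n) u))"

definition scalar_measure :: "(real set \<Rightarrow> 'a ell2 \<Rightarrow> 'a ell2) \<Rightarrow> 'a ell2 \<Rightarrow> real measure"
  where "scalar_measure Q u =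
    measure_of UNIV (sets borel) (\<lambda>X. ennreal (Re (cinner u (Q X u))))"

text \<open>\<open>Q\<close> is the spectral measure of the bounded self-adjoint operator \<open>T\<close>, that is
  \<open>T = \<integral> x dQ(x)\<close>, read weakly; by polarization the diagonal matrix elements suffice.\<close>

definition spectral_measure ::
    "('a ell2 \<Rightarrow> 'a ell2) \<Rightarrow> (real set \<Rightarrow> 'a ell2 \<Rightarrow> 'a ell2) \<Rightarrow> bool"
  where "spectral_measure T Q \<longleftrightarrow> projection_valued_measure Q \<and>
    (\<forall>u. integrable (scalar_measure Q u) (\<lambda>x. x) \<and>
      cinner u (T u) = of_real (\<integral>x. x \<partial>scalar_measure Q u))"

text \<open>\<open>P\<close> is the spectral projection of \<open>T\<close> onto the Borel set \<open>X\<close>. By the spectral theorem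
  it exists and is unique for every bounded self-adjoint \<open>T\<close>.\<close>

definition is_spectral_projection ::
    "('a ell2 \<Rightarrow> 'a ell2) \<Rightarrow> real set \<Rightarrow> ('a ell2 \<Rightarrow> 'a ell2) \<Rightarrow> bool"
  where "is_spectral_projection T X P \<longleftrightarrow> (\<exists>Q. spectral_measure T Q \<and> P = Q X)"


section \<open>Unbounded operators\<close>

text \<open>An unbounded operator is represented by its graph, a set of pairs \<open>(u, T u)\<close>. The closure
  of an operator is the topological \<^const>\<open>closure\<close> of its graph, and its domain is
  \<^const>\<open>Domain\<close>.\<close>

type_synonym 'a graph = "('a ell2 \<times> 'a ell2) set"

definition adjoint_graph :: "'a graph \<Rightarrow> 'a graph"
  where "adjoint_graph T = {(v, w). \<forall>(u, u') \<in> T. cinner u' v = cinner u w}"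

definition self_adjoint :: "'a graph \<Rightarrow> bool"
  where "self_adjoint T \<longleftrightarrow> single_valued T \<and> closure (Domain T) = UNIV \<and> adjoint_graph T = T"

text \<open>Sums of operators on their natural domains: for a finite sum the intersection of the
  domains, for a series those vectors on which it converges in norm. Terms with coefficient zero
  do not restrict the domain, so a finite linear combination is a series of which almost all
  coefficients vanish.\<close>

definition sum_graph :: "('i::finite \<Rightarrow> 'a graph) \<Rightarrow> 'a graph"
  where "sum_graph T = {(u, v). \<exists>w. (\<forall>i. (u, w i) \<in> T i) \<and> v = (\<Sum>i\<in>UNIV. w i)}"

definition series_graph :: "(nat \<Rightarrow> real) \<Rightarrow> (nat \<Rightarrow> 'a graph) \<Rightarrow> 'a graph"
  where "series_graph \<rho> T = {(u, v). \<exists>w.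
    (\<forall>j\<ge>1. \<rho> j \<noteq> 0 \<longrightarrow> (u, w j) \<in> T j) \<and>
    (\<lambda>j. \<rho> (Suc j) *\<^sub>R w (Suc j)) sums v}"

definition compact_support :: "'a ell2 set"
  where "compact_support = {u. finite {n. seq u n \<noteq> 0}}"


section \<open>The discrete Laplacian and the conjugate operators\<close>

text \<open>\<open>shift_fun i k\<close> is \<open>S\<^sub>i\<^sup>k\<close> for an integer \<open>k\<close>, and \<open>position_fun i\<close> is \<open>N\<^sub>i\<close>, on arbitrary
  sequences indexed by the lattice.\<close>

definition shift_fun :: "'d::finite \<Rightarrow> int \<Rightarrow> (int ^ 'd \<Rightarrow> complex) \<Rightarrow> int ^ 'd \<Rightarrow> complex"
  where "shift_fun i k f = (\<lambda>n. f (n - axis i k))"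

definition position_fun :: "'d::finite \<Rightarrow> (int ^ 'd \<Rightarrow> complex) \<Rightarrow> int ^ 'd \<Rightarrow> complex"
  where "position_fun i f = (\<lambda>n. of_int (n $ i) * f n)"

lift_definition shift :: "'d::finite \<Rightarrow> int \<Rightarrow> (int ^ 'd) ell2 \<Rightarrow> (int ^ 'd) ell2"
  is shift_fun
proof -
  fix i :: 'd and k :: int and f :: "int ^ 'd \<Rightarrow> complex"
  assume f: "(\<lambda>n. (cmod (f n))\<^sup>2) summable_on UNIV"
  have "bij_betw (\<lambda>n. n - axis i k) UNIV (UNIV :: (int ^ 'd) set)"
    by (rule bij_betwI[where g = "\<lambda>n. n + axis i k"]) auto
  from summable_on_reindex_bij_betw[OF this, of "\<lambda>n. (cmod (f n))\<^sup>2"] f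
  show "(\<lambda>n. (cmod (shift_fun i k f n))\<^sup>2) summable_on UNIV"
    by (simp add: shift_fun_def)
qed

text \<open>The adjoint of \<open>S\<^sub>i\<close> is its inverse.\<close>

lemma cinner_shift_left: "cinner (shift i k u) v = cinner u (shift i (- k) v)"
proof -
  have "bij_betw (\<lambda>n. n + axis i k) UNIV (UNIV :: (int ^ 'a) set)"
    by (rule bij_betwI[where g = "\<lambda>n. n - axis i k"]) auto
  from infsum_reindex_bij_betw[OF this, of "\<lambda>n. cnj (seq u (n - axis i k)) * seq v n"]
  have "(\<Sum>\<^sub>\<infinity>n. cnj (seq u (n - axis i k)) * seq v n)
      = (\<Sum>\<^sub>\<infinity>n. cnj (seq u n) * seq v (n + axis i k))" by simp
  moreover have "(\<lambda>n. n - axis i (- k)) = (\<lambda>n :: int ^ 'a. n + axis i k)"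
    by (simp add: vec_eq_iff axis_def fun_eq_iff)
  ultimately show ?thesis
    unfolding cinner.rep_eq shift.rep_eq shift_fun_def by metis
qed

definition Laplacian :: "(int ^ 'd::finite) ell2 \<Rightarrow> (int ^ 'd) ell2"
  where "Laplacian u = (\<Sum>i\<in>UNIV. (1 / 2) *\<^sub>R (shift i 1 u + shift i (- 1) u))"

definition dilation_core_fun ::
    "'d::finite \<Rightarrow> nat \<Rightarrow> (int ^ 'd \<Rightarrow> complex) \<Rightarrow> int ^ 'd \<Rightarrow> complex"
  where "dilation_core_fun i k f =
    (let D = (\<lambda>h n. shift_fun i (int k) h n - shift_fun i (- int k) h n)
     in (\<lambda>n. 1 / (4 * \<i>) * (D (position_fun i f) n + position_fun i (D f) n)))"

definition dilation_coord :: "'d::finite \<Rightarrow> nat \<Rightarrow> nat \<Rightarrow> (int ^ 'd) graph"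
  where "dilation_coord i j \<kappa> = closure
    {(u, v). u \<in> compact_support \<and> seq v = dilation_core_fun i (j * \<kappa>) (seq u)}"

text \<open>The sum over the coordinates is understood as the closed, hence self-adjoint, sum.\<close>

definition dilation :: "nat \<Rightarrow> nat \<Rightarrow> (int ^ 'd::finite) graph"
  where "dilation j \<kappa> = closure (sum_graph (\<lambda>i. dilation_coord i j \<kappa>))"

text \<open>The linear combination \<open>\<Sum>j\<ge>1. \<rho> j A\<close> (again closed) of the operators \<open>A = dilation j \<kappa>\<close>
  is admissible if it is self-adjoint and the combination is defined on all compactly supported
  sequences.\<close>

definition conjugate_op :: "nat \<Rightarrow> (int ^ 'd::finite) graph \<Rightarrow> bool"
  where "conjugate_op \<kappa> A \<longleftrightarrow> (\<exists>\<rho> :: nat \<Rightarrow> real.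
    (compact_support :: (int ^ 'd) ell2 set) \<subseteq> Domain (series_graph \<rho> (\<lambda>j. dilation j \<kappa>)) \<and>
    A = closure (series_graph \<rho> (\<lambda>j. dilation j \<kappa>)) \<and>
    self_adjoint A)"

text \<open>\<open>B\<close> is the bounded extension of \<open>[\<Delta>, \<i>A] = \<i>(\<Delta>A - A\<Delta>)\<close>, initially defined on compactly
  supported sequences; these are dense, so \<open>B\<close> is unique.\<close>

definition is_commutator ::
    "(int ^ 'd::finite) graph \<Rightarrow> ((int ^ 'd) ell2 \<Rightarrow> (int ^ 'd) ell2) \<Rightarrow> bool"
  where "is_commutator A B \<longleftrightarrow> bounded_op B \<and>
    (\<forall>u\<in>compact_support. \<forall>v w. (u, v) \<in> A \<longrightarrow> (Laplacian u, w) \<in> A \<longrightarrow>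
      B u = \<i> *\<^sub>C (Laplacian v - w))"


section \<open>Threshold sets\<close>

text \<open>The dimension is passed as a type: \<open>TYPE('d)\<close> stands for \<open>d = CARD('d)\<close>.\<close>

definition spec_Laplacian :: "'d::finite itself \<Rightarrow> real set"
  where "spec_Laplacian _ = {E. complex_of_real E \<in> spectrum (Laplacian :: (int ^ 'd) ell2 \<Rightarrow> _)}"

definition Mourre_set :: "'d::finite itself \<Rightarrow> nat \<Rightarrow> real set"
  where "Mourre_set d \<kappa> = {E \<in> spec_Laplacian d.
    \<exists>(A :: (int ^ 'd) graph) B I P \<gamma>.
      conjugate_op \<kappa> A \<and> is_commutator A B \<and>
      open I \<and> is_interval I \<and> E \<in> I \<and>
      is_spectral_projection Laplacian I P \<and>
      \<gamma> > 0 \<and> op_le (\<lambda>u. \<gamma> *\<^sub>R P u) (\<lambda>u. P (B (P u)))}"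

definition Threshold :: "'d::finite itself \<Rightarrow> nat \<Rightarrow> real set"
  where "Threshold d \<kappa> = spec_Laplacian d - Mourre_set d \<kappa>"

text \<open>Chebyshev polynomials of the second kind.\<close>

fun cheb_U :: "nat \<Rightarrow> real poly" where
  "cheb_U 0 = 1"
| "cheb_U (Suc 0) = [:0, 2:]"
| "cheb_U (Suc (Suc n)) = [:0, 2:] * cheb_U (Suc n) - cheb_U n"

definition g_fun :: "nat \<Rightarrow> real ^ 'd::finite \<Rightarrow> real"
  where "g_fun k x = (\<Sum>i\<in>UNIV. (1 - (x $ i)\<^sup>2) * poly (cheb_U (k - 1)) (x $ i))"

definition energy_surface :: "real \<Rightarrow> (real ^ 'd::finite) set"
  where "energy_surface E = {x. (\<forall>i. x $ i \<in> {-1..1}) \<and> (\<Sum>i\<in>UNIV. x $ i) = E}"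

text \<open>For \<open>m = 0\<close> the sum is empty and the condition reads \<open>g_fun (j * \<kappa>) (x 0) = 0\<close>.\<close>

definition Threshold_level :: "'d::finite itself \<Rightarrow> nat \<Rightarrow> nat \<Rightarrow> real set"
  where "Threshold_level d m \<kappa> = {E \<in> spec_Laplacian d.
    \<exists>(x :: nat \<Rightarrow> real ^ 'd) (\<omega> :: nat \<Rightarrow> real).
      (\<forall>q\<le>m. x q \<in> energy_surface E) \<and> (\<forall>q<m. \<omega> q \<le> 0) \<and>
      (\<forall>j\<ge>1. g_fun (j * \<kappa>) (x m) = (\<Sum>q<m. \<omega> q * g_fun (j * \<kappa>) (x q)))}"

end

theory Submission
  imports Defs
begin

text \<open>
  The first inclusion is a substitution: the conditions at \<open>\<alpha> * \<kappa>\<close> are those at \<open>\<kappa>\<close> for the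
  indices \<open>j * \<alpha>\<close> only.

  For the second one, suppose that a Mourre estimate with constant \<open>\<gamma> > 0\<close> holds on an open
  interval around \<open>E\<close>, for \<open>A = \<Sum>j \<rho>\<^sub>j A\<^sub>j\<close>. In the Fourier representation \<open>\<Delta>\<close> is multiplication
  by \<open>\<Sum>i cos \<theta>\<^sub>i\<close> and its commutator with \<open>\<i> A\<close> is multiplication by
  \<open>G = \<Sum>j \<rho>\<^sub>j g\<^sub>j\<close>, evaluated at \<open>x\<^sub>i = cos \<theta>\<^sub>i\<close>, where \<open>g\<^sub>j\<close> is the function \<open>g_fun (j * \<kappa>)\<close>.
  The estimate should therefore say that \<open>G \<ge> \<gamma>\<close> on the surface \<open>S\<^sub>E\<close>. But if
  \<open>g\<^sub>j(x\<^sub>m) = \<Sum>q \<omega>\<^sub>q g\<^sub>j(x\<^sub>q)\<close> for all \<open>j\<close>, with all \<open>\<omega>\<^sub>q \<le> 0\<close> and all points on \<open>S\<^sub>E\<close>,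
  then also \<open>G(x\<^sub>m) = \<Sum>q \<omega>\<^sub>q G(x\<^sub>q)\<close>, so that \<open>\<gamma> \<le> G(x\<^sub>m) \<le> 0\<close>, a contradiction.

  The surface is a null set of the torus, so \<open>G\<close> must have values at its points and not only almost
  everywhere. It does, because the series that defines \<open>A\<close> has to converge on compactly supported
  sequences: this forces \<open>\<Sum>j j\<^sup>2 \<rho>\<^sub>j\<^sup>2 < \<infinity>\<close>, hence \<open>\<Sum>j \<bar>\<rho>\<^sub>j\<bar> < \<infinity>\<close>
  (\<open>coefficients_summable\<close>), and the series of \<open>G\<close> converges absolutely and uniformly.

  No Fourier transform is used to pass from the estimate to the values of \<open>G\<close>. A point of the
  surface is written \<open>(cos \<theta>\<^sub>i)\<^sub>i\<close>, and the plane wave with momentum \<open>\<theta>\<close>, cut off to larger and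
  larger boxes and normalized, gives unit vectors \<open>u\<^sub>L\<close> of compact support that are approximate
  eigenvectors of every shift (\<open>boxed_plane_wave\<close>). The commutator is a series of shifts
  (\<open>inner_commutator_sums\<close>), so its quadratic form at \<open>u\<^sub>L\<close> tends to \<open>G\<close> at the chosen point.
  Since \<open>(\<Delta> - E) u\<^sub>L\<close> tends to zero, the spectral projection fixes \<open>u\<^sub>L\<close> in the limit
  (\<open>spectral_projection_approx\<close>), and the Mourre estimate applied to \<open>u\<^sub>L\<close> becomes \<open>\<gamma> \<le> G\<close> at
  that point (\<open>Mourre_estimate_pointwise\<close>).
\<close>


section \<open>Square-summable families as a real inner product space\<close>

lemma norm_ell2_infsum: "(norm u)\<^sup>2 = (\<Sum>\<^sub>\<infinity>n. (cmod (seq u n))\<^sup>2)"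
proof -
  have "cinner u u = (\<Sum>\<^sub>\<infinity>n. of_real ((cmod (seq u n))\<^sup>2))"
    unfolding cinner.rep_eq
    by (rule infsum_cong) (metis complex_norm_square mult.commute)
  also have "\<dots> = of_real (\<Sum>\<^sub>\<infinity>n. (cmod (seq u n))\<^sup>2)"
    using seq[of u] by (intro infsumI has_sum_of_real) (simp add: has_sum_infsum)
  finally show ?thesis
    by (simp add: power2_norm_eq_inner inner_ell2_def)
qed

lemma norm_ell2_finite_support:
  assumes "finite F" "\<And>n. n \<notin> F \<Longrightarrow> seq u n = 0"
  shows "(norm u)\<^sup>2 = (\<Sum>n\<in>F. (cmod (seq u n))\<^sup>2)"
proof -
  have "(\<Sum>\<^sub>\<infinity>n. (cmod (seq u n))\<^sup>2) = (\<Sum>\<^sub>\<infinity>n\<in>F. (cmod (seq u n))\<^sup>2)"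
    by (rule infsum_cong_neutral) (use assms in auto)
  then show ?thesis using assms by (simp add: norm_ell2_infsum)
qed

lemma norm_seq_le: "cmod (seq u n) \<le> norm u"
proof -
  have "(\<Sum>\<^sub>\<infinity>m\<in>{n}. (cmod (seq u m))\<^sup>2) \<le> (\<Sum>\<^sub>\<infinity>m. (cmod (seq u m))\<^sup>2)"
    by (rule infsum_mono_neutral) (use seq[of u] in auto)
  then have "(cmod (seq u n))\<^sup>2 \<le> (norm u)\<^sup>2"
    by (simp add: norm_ell2_infsum)
  then show ?thesis by (rule power2_le_imp_le) simp
qed

lemma bounded_linear_seq: "bounded_linear (\<lambda>u. seq u n)"
  by (rule bounded_linear_intro[where K = 1])
    (simp_all add: plus_ell2.rep_eq scaleR_ell2.rep_eq scaleR_conv_of_real norm_seq_le)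

lemmas continuous_on_seq [continuous_intros] =
  bounded_linear.continuous_on[OF bounded_linear_seq]

lemma seq_sum: "seq (\<Sum>i\<in>A. f i) n = (\<Sum>i\<in>A. seq (f i) n)"
  by (rule linear_sum[OF bounded_linear.linear[OF bounded_linear_seq]])

lemmas seq_simps = plus_ell2.rep_eq minus_ell2.rep_eq scaleR_ell2.rep_eq scaleC.rep_eq
  zero_ell2.rep_eq seq_sum

lemma ell2_eqI: "(\<And>n. seq u n = seq v n) \<Longrightarrow> u = v"
  by (simp add: seq_inject[symmetric] fun_eq_iff)

lemma inner_finite_support:
  assumes "finite F" "\<And>n. n \<notin> F \<Longrightarrow> seq u n = 0"
  shows "inner u v = (\<Sum>n\<in>F. Re (cnj (seq u n) * seq v n))"
proof -
  have "(\<Sum>\<^sub>\<infinity>n. cnj (seq u n) * seq v n) = (\<Sum>\<^sub>\<infinity>n\<in>F. cnj (seq u n) * seq v n)"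
    by (rule infsum_cong_neutral) (use assms in auto)
  then show ?thesis using assms by (simp add: inner_ell2_def cinner.rep_eq)
qed

lemma cinner_scaleC_right: "cinner u (c *\<^sub>C v) = c * cinner u v"
proof -
  have "(\<Sum>\<^sub>\<infinity>n. cnj (seq u n) * (c * seq v n)) = (\<Sum>\<^sub>\<infinity>n. c * (cnj (seq u n) * seq v n))"
    by (simp add: ac_simps)
  also have "\<dots> = c * (\<Sum>\<^sub>\<infinity>n. cnj (seq u n) * seq v n)"
    by (intro infsum_cmult_right ell2_summable_mult) (use seq[of u] seq[of v] in auto)
  finally show ?thesis by (simp add: cinner.rep_eq scaleC.rep_eq)
qed

lemma cinner_self: "cinner u u = of_real ((norm u)\<^sup>2)"
proof -
  have "cinner u u = cnj (cinner u u)"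
    by (simp add: cinner.rep_eq mult.commute flip: infsum_cnj)
  then show ?thesis
    by (simp add: complex_eq_iff power2_norm_eq_inner inner_ell2_def)
qed

lemma inner_cis_scale: "inner u (cis a *\<^sub>C u) = cos a * (norm u)\<^sup>2"
  by (simp add: inner_ell2_def cinner_scaleC_right cinner_self)

lemma norm_scaleC: "norm (c *\<^sub>C u) = cmod c * norm u"
proof -
  have "(norm (c *\<^sub>C u))\<^sup>2 = (\<Sum>\<^sub>\<infinity>n. (cmod c)\<^sup>2 * (cmod (seq u n))\<^sup>2)"
    by (simp add: norm_ell2_infsum scaleC.rep_eq norm_mult power_mult_distrib)
  also have "\<dots> = (cmod c * norm u)\<^sup>2"
    using seq[of u] by (subst infsum_cmult_right) (auto simp: norm_ell2_infsum power_mult_distrib)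
  finally show ?thesis by (simp add: power2_eq_iff_nonneg)
qed


section \<open>Shifts and the commutator on compactly supported sequences\<close>

lemma seq_shift: "seq (shift i k u) n = seq u (n - axis i k)"
  by (simp add: shift.rep_eq shift_fun_def)

lemma axis_add: "axis i (a + b :: int) = axis i a + axis i b"
  and axis_uminus: "axis i (- a :: int) = - axis i a"
  and axis_diff: "axis i (a - b :: int) = axis i a - axis i b"
  by (auto simp: vec_eq_iff axis_def)

lemma axis_zero_int: "axis i (0 :: int) = 0"
  by (auto simp: vec_eq_iff axis_def)

lemma shift_shift: "shift i j (shift i k u) = shift i (j + k) u"
  by (rule ell2_eqI) (simp add: seq_shift axis_add algebra_simps)

lemma shift_0: "shift i 0 u = u"
  by (rule ell2_eqI) (simp add: seq_shift axis_zero_int)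

lemma shift_diff: "shift i k (u - v) = shift i k u - shift i k v"
  by (rule ell2_eqI) (simp add: seq_shift seq_simps)

lemma shift_scaleC: "shift i k (c *\<^sub>C u) = c *\<^sub>C shift i k u"
  by (rule ell2_eqI) (simp add: seq_shift seq_simps)

lemma inner_shift_left: "inner (shift i k u) v = inner u (shift i (- k) v)"
  by (simp add: inner_ell2_def cinner_shift_left)

lemma norm_shift: "norm (shift i k u) = norm u"
  by (simp add: norm_eq_sqrt_inner inner_shift_left shift_shift shift_0)

lemma inner_Laplacian: "inner (Laplacian u) v = inner u (Laplacian v)"
  by (simp add: Laplacian_def inner_sum_left inner_sum_right inner_add_left inner_add_right
      inner_shift_left add.commute)

lemma Laplacian_compact_support: "u \<in> compact_support \<Longrightarrow> Laplacian u \<in> compact_support"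
proof -
  assume "u \<in> compact_support"
  then have fin: "finite {n. seq u n \<noteq> 0}" by (simp add: compact_support_def)
  have "{n. seq (Laplacian u) n \<noteq> 0} \<subseteq>
      (\<Union>i. (\<lambda>n. n + axis i 1) ` {n. seq u n \<noteq> 0} \<union> (\<lambda>n. n + axis i (- 1)) ` {n. seq u n \<noteq> 0})"
  proof
    fix n assume "n \<in> {n. seq (Laplacian u) n \<noteq> 0}"
    then have "(\<Sum>i\<in>UNIV. seq ((1 / 2) *\<^sub>R (shift i 1 u + shift i (- 1) u)) n) \<noteq> 0"
      by (simp add: Laplacian_def seq_sum)
    then obtain i where "seq ((1 / 2) *\<^sub>R (shift i 1 u + shift i (- 1) u)) n \<noteq> 0"
      by (metis (no_types, lifting) sum.neutral)
    then have "seq u (n - axis i 1) \<noteq> 0 \<or> seq u (n - axis i (- 1)) \<noteq> 0"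
      by (auto simp: seq_simps seq_shift)
    then show "n \<in> (\<Union>i. (\<lambda>n. n + axis i 1) ` {n. seq u n \<noteq> 0} \<union>
        (\<lambda>n. n + axis i (- 1)) ` {n. seq u n \<noteq> 0})"
    proof
      assume "seq u (n - axis i 1) \<noteq> 0"
      then have "n \<in> (\<lambda>n. n + axis i 1) ` {n. seq u n \<noteq> 0}"
        by (intro image_eqI[where x = "n - axis i 1"]) auto
      then show ?thesis by blast
    next
      assume "seq u (n - axis i (- 1)) \<noteq> 0"
      then have "n \<in> (\<lambda>n. n + axis i (- 1)) ` {n. seq u n \<noteq> 0}"
        by (intro image_eqI[where x = "n - axis i (- 1)"]) auto
      then show ?thesis by blast
    qed
  qed
  then show ?thesis
    unfolding compact_support_def using fin by (auto elim!: finite_subset)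
qed

lemma dilation_core_fun_eq:
  "dilation_core_fun i k f n = 1 / (4 * \<i>) *
    ((2 * of_int (n $ i) - of_nat k) * f (n - axis i (int k))
     - (2 * of_int (n $ i) + of_nat k) * f (n + axis i (int k)))"
proof -
  have "1 / (4 * \<i>) = - \<i> / 4" by (simp add: field_simps)
  then show ?thesis
    by (simp add: dilation_core_fun_def Let_def shift_fun_def position_fun_def axis_uminus
        algebra_simps add_divide_distrib diff_divide_distrib)
qed

text \<open>Convergence in \<open>\<ell>\<^sup>2\<close> implies convergence of each coordinate. A formula that determines every
  coordinate of the image continuously thus survives the closure of a graph, and the closed
  operators below act on their whole domains by the expressions that define them on the core.\<close>

lemma closed_graph_coordinates:
  fixes \<Phi> :: "('a \<Rightarrow> complex) \<Rightarrow> 'a \<Rightarrow> complex"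
  assumes "\<And>n. continuous_on UNIV (\<lambda>u. \<Phi> (seq u) n)"
  shows "closed {(u, v). seq v = \<Phi> (seq u)}"
proof -
  have "{(u, v). seq v = \<Phi> (seq u)} = (\<Inter>n. {p. seq (snd p) n = \<Phi> (seq (fst p)) n})"
    by (auto simp: fun_eq_iff)
  moreover have "closed {p. seq (snd p) n = \<Phi> (seq (fst p)) n}" for n
    by (intro closed_Collect_eq continuous_intros continuous_on_compose2[OF assms]) auto
  ultimately show ?thesis by auto
qed

lemma dilation_coord_seq:
  assumes "(u, v) \<in> dilation_coord i j \<kappa>"
  shows "seq v = dilation_core_fun i (j * \<kappa>) (seq u)"
proof -
  have "closed {(u, v). seq v = dilation_core_fun i (j * \<kappa>) (seq u)}"
    by (intro closed_graph_coordinates)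
      (simp only: dilation_core_fun_eq, intro continuous_intros)
  then have "dilation_coord i j \<kappa> \<subseteq> {(u, v). seq v = dilation_core_fun i (j * \<kappa>) (seq u)}"
    unfolding dilation_coord_def by (intro closure_minimal) auto
  then show ?thesis using assms by auto
qed

lemma dilation_seq:
  assumes "(u, v) \<in> dilation j \<kappa>"
  shows "seq v = (\<lambda>n. \<Sum>i\<in>UNIV. dilation_core_fun i (j * \<kappa>) (seq u) n)"
proof -
  let ?G = "{(u, v). seq v = (\<lambda>n. \<Sum>i\<in>UNIV. dilation_core_fun i (j * \<kappa>) (seq u) n)}"
  have "closed ?G"
    by (intro closed_graph_coordinates)
      (simp only: dilation_core_fun_eq, intro continuous_intros)
  moreover have "sum_graph (\<lambda>i. dilation_coord i j \<kappa>) \<subseteq> ?G"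
  proof
    fix p assume "p \<in> sum_graph (\<lambda>i. dilation_coord i j \<kappa>)"
    then obtain u w where p: "p = (u, \<Sum>i\<in>UNIV. w i)"
      and w: "\<And>i. (u, w i) \<in> dilation_coord i j \<kappa>"
      by (auto simp: sum_graph_def)
    show "p \<in> ?G" unfolding p using dilation_coord_seq[OF w] by (simp add: seq_sum fun_eq_iff)
  qed
  ultimately have "dilation j \<kappa> \<subseteq> ?G"
    unfolding dilation_def by (intro closure_minimal)
  then show ?thesis using assms by auto
qed

lemma series_graph_dilation_sums:
  assumes "(u, v) \<in> series_graph \<rho> (\<lambda>j. dilation j \<kappa>)"
  shows "(\<lambda>j. of_real (\<rho> (Suc j)) *
    (\<Sum>i\<in>UNIV. dilation_core_fun i (Suc j * \<kappa>) (seq u) n)) sums seq v n"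
proof -
  obtain w where w: "\<And>j. j \<ge> 1 \<Longrightarrow> \<rho> j \<noteq> 0 \<Longrightarrow> (u, w j) \<in> dilation j \<kappa>"
    and s: "(\<lambda>j. \<rho> (Suc j) *\<^sub>R w (Suc j)) sums v"
    using assms by (auto simp: series_graph_def)
  have "(\<lambda>j. seq (\<rho> (Suc j) *\<^sub>R w (Suc j)) n) sums seq v n"
    by (rule bounded_linear.sums[OF bounded_linear_seq s])
  moreover have "seq (\<rho> (Suc j) *\<^sub>R w (Suc j)) n = of_real (\<rho> (Suc j)) *
    (\<Sum>i\<in>UNIV. dilation_core_fun i (Suc j * \<kappa>) (seq u) n)" for j
    using dilation_seq[OF w[of "Suc j"]] by (cases "\<rho> (Suc j) = 0") (auto simp: seq_simps)
  ultimately show ?thesis by simp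
qed

text \<open>This is \<open>[\<Delta>, \<i> A]\<close> for the single operator \<open>A = \<Sum>i A\<^sub>i\<close> with step \<open>k\<close>. Its \<open>i\<close>-th summand has
  the Fourier symbol \<open>(cos ((k - 1) \<theta>\<^sub>i) - cos ((k + 1) \<theta>\<^sub>i)) / 2 = sin \<theta>\<^sub>i sin (k \<theta>\<^sub>i)\<close>.\<close>

definition dilation_commutator :: "nat \<Rightarrow> (int ^ 'd::finite) ell2 \<Rightarrow> (int ^ 'd) ell2"
  where "dilation_commutator k u = (\<Sum>i\<in>UNIV. (1 / 4) *\<^sub>R
    (shift i (int k - 1) u + shift i (1 - int k) u
     - shift i (int k + 1) u - shift i (- int k - 1) u))"

text \<open>Only the position operator fails to commute with a shift, and only along the same axis, where
  the commutator is again a multiple of the shift. The growing factor \<open>n\<^sub>i\<close> therefore cancels.\<close>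

lemma dilation_core_fun_shift:
  "dilation_core_fun i k f (n - axis l s) - dilation_core_fun i k (shift_fun l s f) n
   = (if i = l then \<i> * of_int s / 2 * (f (n - axis i (s + int k)) - f (n - axis i (s - int k))) else 0)"
proof (cases "i = l")
  case True
  have "1 / (4 * \<i>) = - \<i> / 4" by (simp add: field_simps)
  then show ?thesis using True
    by (simp add: dilation_core_fun_eq shift_fun_def axis_add axis_diff algebra_simps)
next
  case False
  then show ?thesis
    by (simp add: dilation_core_fun_eq shift_fun_def axis_def algebra_simps)
qed

lemma dilation_commutator_seq:
  "\<i> * ((\<Sum>l\<in>UNIV. 1 / 2 *
        ((\<Sum>i\<in>UNIV. dilation_core_fun i k (seq u) (n - axis l 1))
         + (\<Sum>i\<in>UNIV. dilation_core_fun i k (seq u) (n - axis l (- 1)))))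
      - (\<Sum>i\<in>UNIV. dilation_core_fun i k (seq (Laplacian u)) n))
   = seq (dilation_commutator k u) n"
proof -
  let ?D = "\<lambda>i l s. dilation_core_fun i k (seq u) (n - axis l s)
    - dilation_core_fun i k (shift_fun l s (seq u)) n"
  have lin: "dilation_core_fun i k (seq (Laplacian u)) n =
      (\<Sum>l\<in>UNIV. 1 / 2 * (dilation_core_fun i k (shift_fun l 1 (seq u)) n
        + dilation_core_fun i k (shift_fun l (- 1) (seq u)) n))" for i
  proof -
    have lin: "c * (p * (\<Sum>l\<in>UNIV. h * (F l + G l)) - q * (\<Sum>l\<in>UNIV. h * (F' l + G' l)))
        = (\<Sum>l\<in>UNIV. h * (c * (p * F l - q * F' l) + c * (p * G l - q * G' l)))"
      for c h p q :: complex and F F' G G' :: "'a \<Rightarrow> complex"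
      unfolding sum_distrib_left sum_subtractf[symmetric]
      by (rule sum.cong) (auto simp: algebra_simps)
    have Lap: "seq (Laplacian u) m =
        (\<Sum>l\<in>UNIV. 1 / 2 * (shift_fun l 1 (seq u) m + shift_fun l (- 1) (seq u) m))" for m
      by (simp add: Laplacian_def seq_simps shift.rep_eq)
    show ?thesis unfolding dilation_core_fun_eq Lap by (rule lin)
  qed
  have regroup: "c * ((\<Sum>l\<in>UNIV. h * ((\<Sum>i\<in>UNIV. a l i) + (\<Sum>i\<in>UNIV. b l i)))
      - (\<Sum>i\<in>UNIV. \<Sum>l\<in>UNIV. h * (a' l i + b' l i)))
    = (\<Sum>l\<in>UNIV. \<Sum>i\<in>UNIV. c * h * ((a l i - a' l i) + (b l i - b' l i)))"
    for c h :: complex and a b a' b' :: "'a \<Rightarrow> 'a \<Rightarrow> complex"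
  proof -
    have "(\<Sum>i\<in>UNIV. \<Sum>l\<in>UNIV. h * (a' l i + b' l i)) = (\<Sum>l\<in>UNIV. \<Sum>i\<in>UNIV. h * (a' l i + b' l i))"
      by (rule sum.swap)
    then show ?thesis
      by (simp add: sum_distrib_left sum.distrib sum_subtractf algebra_simps)
  qed
  have "\<i> * ((\<Sum>l\<in>UNIV. 1 / 2 *
        ((\<Sum>i\<in>UNIV. dilation_core_fun i k (seq u) (n - axis l 1))
         + (\<Sum>i\<in>UNIV. dilation_core_fun i k (seq u) (n - axis l (- 1)))))
      - (\<Sum>i\<in>UNIV. dilation_core_fun i k (seq (Laplacian u)) n))
    = (\<Sum>l\<in>UNIV. \<Sum>i\<in>UNIV. \<i> * (1 / 2) * (?D i l 1 + ?D i l (- 1)))"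
    unfolding lin by (rule regroup)
  also have "\<dots> = (\<Sum>l\<in>UNIV. \<Sum>i\<in>UNIV. \<i> / 2 * (?D i l 1 + ?D i l (- 1)))"
    by simp
  also have "\<dots> = (\<Sum>l\<in>UNIV. \<i> / 2 * (?D l l 1 + ?D l l (- 1)))"
  proof (rule sum.cong[OF refl])
    fix l :: 'a
    have "\<i> / 2 * (?D i l 1 + ?D i l (- 1)) =
        (if i = l then \<i> / 2 * (?D l l 1 + ?D l l (- 1)) else 0)" for i
      by (simp add: dilation_core_fun_shift)
    \<comment> \<open>a shift commutes with the dilation generators of the other axes\<close>
    then have "(\<Sum>i\<in>UNIV. \<i> / 2 * (?D i l 1 + ?D i l (- 1))) =
        (\<Sum>i\<in>UNIV. if i = l then \<i> / 2 * (?D l l 1 + ?D l l (- 1)) else 0)"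
      by (rule sum.cong[OF refl])
    also have "\<dots> = \<i> / 2 * (?D l l 1 + ?D l l (- 1))"
      by (subst sum.delta) (rule finite, rule if_P, rule UNIV_I)
    finally show "(\<Sum>i\<in>UNIV. \<i> / 2 * (?D i l 1 + ?D i l (- 1))) =
        \<i> / 2 * (?D l l 1 + ?D l l (- 1))" .
  qed
  also have "\<dots> = seq (dilation_commutator k u) n"
  proof -
    have "\<i> / 2 * (?D l l 1 + ?D l l (- 1)) = seq ((1 / 4) *\<^sub>R
      (shift l (int k - 1) u + shift l (1 - int k) u
       - shift l (int k + 1) u - shift l (- int k - 1) u)) n" for l
      unfolding dilation_core_fun_shift minus_diff_commute[of "int k" 1]
      by (simp add: seq_simps seq_shift algebra_simps)
    then show ?thesis by (simp add: dilation_commutator_def seq_sum)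
  qed
  finally show ?thesis .
qed

text \<open>The domain condition makes both \<open>A u\<close> and \<open>A (\<Delta> u)\<close> available as series, so the bounded
  operator \<open>B\<close> can be computed on \<open>u\<close> one coordinate at a time. Coordinatewise convergence
  suffices: the quadratic form at a compactly supported vector involves finitely many
  coordinates.\<close>

lemma commutator_sums:
  fixes u :: "(int ^ 'd::finite) ell2"
  assumes B: "is_commutator (closure (series_graph \<rho> (\<lambda>j. dilation j \<kappa>))) B"
    and dom: "(compact_support :: (int ^ 'd) ell2 set)
      \<subseteq> Domain (series_graph \<rho> (\<lambda>j. dilation j \<kappa>))"
    and u: "u \<in> compact_support"
  shows "(\<lambda>j. of_real (\<rho> (Suc j)) * seq (dilation_commutator (Suc j * \<kappa>) u) n) sums seq (B u) n"
proof -
  let ?S = "series_graph \<rho> (\<lambda>j. dilation j \<kappa>)"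
  obtain v w where v: "(u, v) \<in> ?S" and w: "(Laplacian u, w) \<in> ?S"
    using dom u Laplacian_compact_support[OF u] by blast
  then have "B u = \<i> *\<^sub>C (Laplacian v - w)"
    using B u closure_subset[of ?S] unfolding is_commutator_def by blast
  then have Bn: "seq (B u) n = \<i> * ((\<Sum>l\<in>UNIV. 1 / 2 *
      (seq v (n - axis l 1) + seq v (n - axis l (- 1)))) - seq w n)"
    by (simp add: Laplacian_def seq_simps seq_shift)
  note sv = series_graph_dilation_sums[OF v] and sw = series_graph_dilation_sums[OF w]
  have "(\<lambda>j. \<i> * ((\<Sum>l\<in>UNIV. 1 / 2 *
        (of_real (\<rho> (Suc j)) * (\<Sum>i\<in>UNIV. dilation_core_fun i (Suc j * \<kappa>) (seq u) (n - axis l 1))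
         + of_real (\<rho> (Suc j)) * (\<Sum>i\<in>UNIV. dilation_core_fun i (Suc j * \<kappa>) (seq u) (n - axis l (- 1)))))
      - of_real (\<rho> (Suc j)) * (\<Sum>i\<in>UNIV. dilation_core_fun i (Suc j * \<kappa>) (seq (Laplacian u)) n)))
    sums seq (B u) n"
    unfolding Bn by (intro sums_mult sums_diff sums_sum sums_add sv sw)
  moreover have "\<i> * ((\<Sum>l\<in>UNIV. 1 / 2 *
        (c * (\<Sum>i\<in>UNIV. dilation_core_fun i k (seq u) (n - axis l 1))
         + c * (\<Sum>i\<in>UNIV. dilation_core_fun i k (seq u) (n - axis l (- 1)))))
      - c * (\<Sum>i\<in>UNIV. dilation_core_fun i k (seq (Laplacian u)) n))
    = c * seq (dilation_commutator k u) n" for c k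
    unfolding dilation_commutator_seq[symmetric]
    by (simp only: distrib_left[symmetric] mult.left_commute[of _ c] sum_distrib_left[symmetric]
        right_diff_distrib[symmetric])
  ultimately show ?thesis by simp
qed

lemma inner_commutator_sums:
  fixes u :: "(int ^ 'd::finite) ell2"
  assumes B: "is_commutator (closure (series_graph \<rho> (\<lambda>j. dilation j \<kappa>))) B"
    and dom: "(compact_support :: (int ^ 'd) ell2 set)
      \<subseteq> Domain (series_graph \<rho> (\<lambda>j. dilation j \<kappa>))"
    and u: "u \<in> compact_support"
  shows "(\<lambda>j. \<rho> (Suc j) * inner u (dilation_commutator (Suc j * \<kappa>) u)) sums inner u (B u)"
proof -
  let ?F = "{n. seq u n \<noteq> 0}"
  have fin: "finite ?F" using u by (simp add: compact_support_def)
  have inn: "inner u v = (\<Sum>n\<in>?F. Re (cnj (seq u n) * seq v n))" for v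
    using fin by (intro inner_finite_support) auto
  have "(\<lambda>j. \<Sum>n\<in>?F. Re (cnj (seq u n) *
      (of_real (\<rho> (Suc j)) * seq (dilation_commutator (Suc j * \<kappa>) u) n))) sums
    (\<Sum>n\<in>?F. Re (cnj (seq u n) * seq (B u) n))"
    by (intro sums_sum sums_Re sums_mult commutator_sums[OF assms])
  moreover have "(\<Sum>n\<in>?F. Re (cnj (seq u n) * (of_real c * seq v n))) = c * inner u v" for c v
    unfolding inn sum_distrib_left by (intro sum.cong) (auto simp: algebra_simps)
  ultimately show ?thesis by (simp add: inn)
qed

text \<open>Apply the series to the unit vector at the origin. The \<open>j\<close>-th operator moves it to the sites at
  distance \<open>j * \<kappa>\<close> along the axes, with weight proportional to \<open>j * \<kappa>\<close>. These sites differ for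
  different \<open>j\<close>, so the coordinates of the limit show \<open>j \<rho>\<^sub>j\<close> up to a constant; they are square
  summable, and \<open>\<bar>\<rho>\<^sub>j\<bar> \<le> (j \<rho>\<^sub>j)\<^sup>2 + 1 / j\<^sup>2\<close>.\<close>

lemma coefficients_summable:
  fixes \<rho> :: "nat \<Rightarrow> real"
  assumes dom: "(compact_support :: (int ^ 'd::finite) ell2 set)
      \<subseteq> Domain (series_graph \<rho> (\<lambda>j. dilation j \<kappa>))"
    and \<kappa>: "\<kappa> \<ge> 1"
  shows "summable (\<lambda>j. \<bar>\<rho> (Suc j)\<bar>)"
proof -
  define \<delta> :: "(int ^ 'd) ell2" where "\<delta> = Abs_ell2 (\<lambda>n. if n = 0 then 1 else 0)"
  have \<delta>: "seq \<delta> = (\<lambda>n. if n = 0 then 1 else 0)"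
  proof -
    have "(\<lambda>n. (cmod (if n = (0 :: int ^ 'd) then 1 else 0))\<^sup>2) summable_on UNIV"
      by (rule finite_nonzero_values_imp_summable_on, rule finite_subset[of _ "{0}"]) auto
    then show ?thesis unfolding \<delta>_def by (simp add: Abs_ell2_inverse)
  qed
  then have "\<delta> \<in> compact_support" by (simp add: compact_support_def)
  then obtain v where v: "(\<delta>, v) \<in> series_graph \<rho> (\<lambda>j. dilation j \<kappa>)" using dom by blast
  obtain i :: 'd where True by simp
  have core: "(\<Sum>l\<in>UNIV. dilation_core_fun l (Suc j' * \<kappa>) (seq \<delta>) (axis i (int (Suc j * \<kappa>))))
      = (if j' = j then of_nat (Suc j * \<kappa>) / (4 * \<i>) else 0)" for j j'
  proof -
    have ne: "axis i (int (Suc j * \<kappa>)) + axis l (int (Suc j' * \<kappa>)) \<noteq> 0" for l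
    proof
      assume "axis i (int (Suc j * \<kappa>)) + axis l (int (Suc j' * \<kappa>)) = 0"
      then have "(axis i (int (Suc j * \<kappa>)) + axis l (int (Suc j' * \<kappa>))) $ i = 0" by simp
      moreover have "int (Suc j * \<kappa>) > 0" "int (Suc j' * \<kappa>) > 0"
        using \<kappa> by (simp_all only: of_nat_0_less_iff nat_0_less_mult_iff) simp_all
      ultimately show False by (auto simp: axis_def split: if_splits)
    qed
    have eq: "axis i (int (Suc j * \<kappa>)) - axis l (int (Suc j' * \<kappa>)) = 0 \<longleftrightarrow> l = i \<and> j' = j" for l
    proof -
      have "int (Suc j * \<kappa>) \<noteq> 0" using \<kappa> by (simp only: of_nat_eq_0_iff mult_eq_0_iff) simp
      moreover have "int (Suc j * \<kappa>) = int (Suc j' * \<kappa>) \<longleftrightarrow> j' = j" using \<kappa> by auto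
      ultimately show ?thesis by (auto simp: axis_eq_axis)
    qed
    have "dilation_core_fun l (Suc j' * \<kappa>) (seq \<delta>) (axis i (int (Suc j * \<kappa>))) =
        (if l = i then if j' = j then of_nat (Suc j * \<kappa>) / (4 * \<i>) else 0 else 0)" for l
      unfolding dilation_core_fun_eq \<delta> eq if_not_P[OF ne]
      by (cases "l = i \<and> j' = j") (auto simp del: of_nat_mult of_nat_Suc mult_Suc)
    then show ?thesis by simp
  qed
  have coeff: "seq v (axis i (int (Suc j * \<kappa>))) =
      of_real (\<rho> (Suc j)) * (of_nat (Suc j * \<kappa>) / (4 * \<i>))" for j
  proof -
    have "(\<lambda>j'. of_real (\<rho> (Suc j')) * (if j' = j then of_nat (Suc j * \<kappa>) / (4 * \<i>) else 0))
        sums seq v (axis i (int (Suc j * \<kappa>)))"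
      using series_graph_dilation_sums[OF v, of "axis i (int (Suc j * \<kappa>))"]
      unfolding core .
    moreover have "(\<lambda>j'. of_real (\<rho> (Suc j')) * (if j' = j then of_nat (Suc j * \<kappa>) / (4 * \<i>) else 0))
        = (\<lambda>j'. if j' = j then of_real (\<rho> (Suc j')) * (of_nat (Suc j * \<kappa>) / (4 * \<i>)) else 0)"
      by auto
    ultimately show ?thesis
      using sums_single[of j "\<lambda>j'. of_real (\<rho> (Suc j')) * (of_nat (Suc j * \<kappa>) / (4 * \<i>))"]
      by (simp add: sums_unique2)
  qed
  have inj: "inj (\<lambda>j. axis i (int (Suc j * \<kappa>)))"
  proof (rule injI)
    fix a b assume "axis i (int (Suc a * \<kappa>)) = axis i (int (Suc b * \<kappa>))"
    then have "int (Suc a * \<kappa>) = int (Suc b * \<kappa>)" by (metis axis_nth)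
    then show "a = b" using \<kappa> by (simp only: of_nat_eq_iff mult_cancel2) simp
  qed
  have "(\<lambda>n. (cmod (seq v n))\<^sup>2) summable_on range (\<lambda>j. axis i (int (Suc j * \<kappa>)))"
    by (rule summable_on_subset_banach[where A = UNIV]) (use seq[of v] in auto)
  then have "(\<lambda>j. (cmod (seq v (axis i (int (Suc j * \<kappa>)))))\<^sup>2) summable_on UNIV"
    by (subst (asm) summable_on_reindex[OF inj]) (simp add: o_def)
  then have sq: "summable (\<lambda>j. (cmod (seq v (axis i (int (Suc j * \<kappa>)))))\<^sup>2)"
    by (rule summable_on_imp_summable)
  have "summable (\<lambda>j. 16 * (cmod (seq v (axis i (int (Suc j * \<kappa>)))))\<^sup>2 + inverse ((real (Suc j))\<^sup>2))"
    by (intro summable_add summable_mult sq)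
      (use inverse_power_summable[of 2, where 'a = real] in \<open>subst summable_Suc_iff, simp\<close>)
  then show ?thesis
  proof (rule summable_comparison_test_ev[rotated], intro always_eventually allI)
    fix j
    define a where "a = \<bar>\<rho> (Suc j)\<bar> * real (Suc j)"
    define b where "b = inverse (real (Suc j))"
    have b: "b > 0" by (simp add: b_def)
    have "norm \<bar>\<rho> (Suc j)\<bar> = a * b" by (simp add: a_def b_def field_simps)
    also have "\<dots> \<le> a\<^sup>2 + b\<^sup>2"
    proof -
      have "0 \<le> (a - b)\<^sup>2" "0 \<le> a * b" using b by (simp_all add: a_def)
      then show ?thesis by (simp add: power2_diff)
    qed
    also have "a \<le> 4 * cmod (seq v (axis i (int (Suc j * \<kappa>))))"
    proof -
      have "a * 1 \<le> a * real \<kappa>" using \<kappa> by (intro mult_left_mono) (auto simp: a_def)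
      also have "\<dots> = 4 * cmod (seq v (axis i (int (Suc j * \<kappa>))))"
        unfolding coeff norm_mult norm_divide norm_of_nat norm_of_real
        by (simp add: a_def norm_mult del: of_nat_Suc mult_Suc)
      finally show ?thesis by simp
    qed
    then have "a\<^sup>2 \<le> (4 * cmod (seq v (axis i (int (Suc j * \<kappa>)))))\<^sup>2"
      by (intro power_mono) (auto simp: a_def)
    finally show "norm \<bar>\<rho> (Suc j)\<bar> \<le>
        16 * (cmod (seq v (axis i (int (Suc j * \<kappa>)))))\<^sup>2 + inverse ((real (Suc j))\<^sup>2)"
      by (simp add: power_mult_distrib b_def power_inverse)
  qed
qed


section \<open>Localization by a spectral measure\<close>

context
  fixes Q :: "real set \<Rightarrow> 'a ell2 \<Rightarrow> 'a ell2"
  assumes pvm: "projection_valued_measure Q"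
begin

lemma pvm_projection: "X \<in> sets borel \<Longrightarrow> orth_projection (Q X)"
  using pvm by (simp add: projection_valued_measure_def)

lemma pvm_Int: "X \<in> sets borel \<Longrightarrow> Y \<in> sets borel \<Longrightarrow> Q X (Q Y u) = Q (X \<inter> Y) u"
  using pvm by (simp add: projection_valued_measure_def)

lemma pvm_bounded_linear: "X \<in> sets borel \<Longrightarrow> bounded_linear (Q X)"
  using pvm_projection by (simp add: orth_projection_def bounded_op_def)

lemma pvm_sums:
  assumes "range F \<subseteq> sets borel" "disjoint_family F"
  shows "(\<lambda>n. Q (F n) u) sums Q (\<Union>n. F n) u"
  using assms pvm by (simp add: projection_valued_measure_def)

lemma pvm_inner: "X \<in> sets borel \<Longrightarrow> inner (Q X u) v = inner u (Q X v)"
  using pvm_projection by (simp add: orth_projection_def inner_ell2_def)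

lemma pvm_norm_sq: "X \<in> sets borel \<Longrightarrow> inner u (Q X u) = (norm (Q X u))\<^sup>2"
  by (simp add: power2_norm_eq_inner pvm_inner pvm_Int)

lemma pvm_empty: "Q {} u = 0"
proof -
  have "(\<lambda>n::nat. Q {} u) sums Q {} u"
    using pvm_sums[of "\<lambda>_. {}" u] by (simp add: disjoint_family_on_def)
  then have "(\<lambda>n::nat. Q {} u) \<longlonglongrightarrow> 0"
    by (intro summable_LIMSEQ_zero) (rule sums_summable)
  then show ?thesis by (simp add: LIMSEQ_const_iff)
qed

lemma pvm_Un:
  assumes "X \<in> sets borel" "Y \<in> sets borel" "X \<inter> Y = {}"
  shows "Q (X \<union> Y) u = Q X u + Q Y u"
proof -
  have "(\<lambda>n. Q (binaryset X Y n) u) sums Q (\<Union>n. binaryset X Y n) u"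
    using assms by (intro pvm_sums) (auto simp: range_binaryset_eq disjoint_family_on_def
        binaryset_def)
  moreover have "(\<lambda>n. Q (binaryset X Y n) u) sums (Q X u + Q Y u)"
    by (rule binaryset_sums) (rule pvm_empty)
  ultimately show ?thesis by (simp add: UN_binaryset_eq sums_unique2)
qed

lemma pvm_Compl: "X \<in> sets borel \<Longrightarrow> u = Q X u + Q (- X) u"
  using pvm_Un[of X "- X" u] pvm by (simp add: projection_valued_measure_def)

lemma sets_scalar_measure [measurable_cong, simp]: "sets (scalar_measure Q u) = sets borel"
  using sets.sigma_sets_eq[of "borel :: real measure"]
  by (simp add: scalar_measure_def)

lemma space_scalar_measure [simp]: "space (scalar_measure Q u) = UNIV"
  by (simp add: scalar_measure_def space_measure_of_conv)

lemma emeasure_scalar_measure: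
  assumes X: "X \<in> sets borel"
  shows "emeasure (scalar_measure Q u) X = ennreal ((norm (Q X u))\<^sup>2)"
proof -
  let ?\<mu> = "\<lambda>X. ennreal (Re (cinner u (Q X u)))"
  have \<mu>: "?\<mu> Y = ennreal ((norm (Q Y u))\<^sup>2)" if "Y \<in> sets borel" for Y
    using pvm_norm_sq[OF that, of u] by (simp add: inner_ell2_def)
  have "sigma_algebra UNIV (sets (borel :: real measure))"
    using sets.sigma_algebra_axioms[of "borel :: real measure"] by simp
  moreover have "positive (sets borel) ?\<mu>"
    using \<mu>[of "{}"] by (simp add: positive_def pvm_empty)
  moreover have "countably_additive (sets borel) ?\<mu>"
  proof (rule countably_additiveI)
    fix F :: "nat \<Rightarrow> real set"
    assume F: "range F \<subseteq> sets borel" "disjoint_family F" "(\<Union>i. F i) \<in> sets borel"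
    have s: "(\<lambda>n. inner u (Q (F n) u)) sums inner u (Q (\<Union>n. F n) u)"
      by (intro bounded_linear.sums[OF bounded_linear_inner_right] pvm_sums F)
    have "(\<Sum>n. ennreal (inner u (Q (F n) u))) = ennreal (\<Sum>n. inner u (Q (F n) u))"
      using F by (intro suminf_ennreal2 sums_summable[OF s]) (auto simp: pvm_norm_sq)
    then show "(\<Sum>n. ?\<mu> (F n)) = ?\<mu> (\<Union>n. F n)"
      using sums_unique[OF s] by (simp add: inner_ell2_def)
  qed
  ultimately have "emeasure (scalar_measure Q u) X = ?\<mu> X"
    unfolding scalar_measure_def using X by (intro emeasure_measure_of_sigma)
  then show ?thesis using \<mu>[OF X] by simp
qed

lemma finite_scalar_measure: "finite_measure (scalar_measure Q u)"
  by (rule finite_measureI) (simp add: emeasure_scalar_measure)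

text \<open>Projecting the vector restricts its scalar spectral measure, which turns the splitting of
  a vector into a splitting of the integral that defines its quadratic form.\<close>

lemma scalar_measure_restrict:
  assumes Y: "Y \<in> sets borel"
  shows "scalar_measure Q (Q Y u) = density (scalar_measure Q u) (\<lambda>x. ennreal (indicator Y x))"
proof (rule measure_eqI)
  fix X assume "X \<in> sets (scalar_measure Q (Q Y u))"
  then have X: "X \<in> sets borel" by simp
  then show "emeasure (scalar_measure Q (Q Y u)) X =
      emeasure (density (scalar_measure Q u) (\<lambda>x. ennreal (indicator Y x))) X"
    using Y by (simp add: ennreal_indicator emeasure_restricted emeasure_scalar_measure pvm_Int
        Int_commute)
qed simp

context
  fixes T :: "'a ell2 \<Rightarrow> 'a ell2"
  assumes spec: "spectral_measure T Q"
    and lin: "linear T"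
    and sym: "\<And>u v. inner (T u) v = inner u (T v)"
begin

lemma spectral_integral:
  "integrable (scalar_measure Q u) (\<lambda>x. x)"
  "inner u (T u) = (\<integral>x. x \<partial>scalar_measure Q u)"
  using spec by (auto simp: spectral_measure_def inner_ell2_def)

lemma quadratic_form_split:
  assumes Y: "Y \<in> sets borel"
  shows "inner u (T u) = inner (Q Y u) (T (Q Y u)) + inner (Q (- Y) u) (T (Q (- Y) u))"
proof -
  have part: "inner (Q Z u) (T (Q Z u)) = (\<integral>x. indicator Z x * x \<partial>scalar_measure Q u)"
    if "Z \<in> sets borel" for Z
    unfolding spectral_integral(2) scalar_measure_restrict[OF that]
    using that by (subst integral_density) auto
  have int: "integrable (scalar_measure Q u) (\<lambda>x. indicator Z x * x)" if "Z \<in> sets borel" for Z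
    using integrable_mult_indicator[OF _ spectral_integral(1)[of u], of Z] that by simp
  have "(\<integral>x. x \<partial>scalar_measure Q u) =
      (\<integral>x. indicator Y x * x + indicator (- Y) x * x \<partial>scalar_measure Q u)"
    by (rule Bochner_Integration.integral_cong) (auto simp: indicator_def)
  also have "\<dots> = (\<integral>x. indicator Y x * x \<partial>scalar_measure Q u)
      + (\<integral>x. indicator (- Y) x * x \<partial>scalar_measure Q u)"
    using Y by (intro Bochner_Integration.integral_add int) auto
  finally show ?thesis using Y by (simp add: part spectral_integral(2)[of u])
qed

text \<open>The link between \<open>T\<close> and \<open>Q\<close> is given for diagonal matrix elements only. That \<open>T\<close> does not mix
  complementary spectral subspaces follows from \<open>quadratic_form_split\<close> for a sum \<open>v + w\<close> of one
  vector from each: the two cross terms of the quadratic form add up to zero, and by symmetry of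
  \<open>T\<close> they are equal.\<close>

lemma spectral_subspace_reduces:
  assumes Y: "Y \<in> sets borel"
  shows "inner (Q Y a) (T (Q (- Y) b)) = 0"
proof -
  define v w where "v = Q Y a" and "w = Q (- Y) b"
  have QY: "linear (Q Y)" "linear (Q (- Y))"
    using Y by (auto intro!: bounded_linear.linear pvm_bounded_linear borel_comp)
  have "Q Y (v + w) = v" "Q (- Y) (v + w) = w"
    using Y by (simp_all add: linear_add[OF QY(1)] linear_add[OF QY(2)] v_def w_def pvm_Int
        pvm_empty)
  then have "inner (v + w) (T (v + w)) = inner v (T v) + inner w (T w)"
    using quadratic_form_split[OF Y, of "v + w"] by simp
  then have "inner v (T w) + inner w (T v) = 0"
    by (simp add: linear_add[OF lin] inner_add_left inner_add_right)
  moreover have "inner w (T v) = inner v (T w)"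
    by (metis inner_commute sym)
  ultimately show ?thesis by (simp add: v_def w_def)
qed

text \<open>The sign \<open>s\<close> lets one argument treat the spectral subspaces on both sides of \<open>E\<close>.\<close>

lemma quadratic_form_lower_bound:
  assumes X: "X \<in> sets borel" and le: "\<And>x. x \<in> X \<Longrightarrow> \<epsilon> \<le> s * (x - E)"
  shows "\<epsilon> * (norm (Q X u))\<^sup>2 \<le> s * (inner (Q X u) (T (Q X u)) - E * (norm (Q X u))\<^sup>2)"
proof -
  let ?w = "Q X u"
  let ?M = "scalar_measure Q ?w"
  interpret finite_measure ?M by (rule finite_scalar_measure)
  have total: "measure ?M UNIV = (norm ?w)\<^sup>2"
    using emeasure_scalar_measure[of UNIV ?w] pvm
    by (simp add: measure_def projection_valued_measure_def)
  have "emeasure ?M (- X) = 0"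
    using X by (simp add: emeasure_scalar_measure pvm_Int pvm_empty)
  then have "AE x in ?M. x \<in> X"
    using X by (intro AE_I[of _ _ "- X"]) auto
  then have "AE x in ?M. \<epsilon> \<le> s * (x - E)"
    by (rule eventually_mono) (rule le)
  then have "(\<integral>x. \<epsilon> \<partial>?M) \<le> (\<integral>x. s * (x - E) \<partial>?M)"
    by (intro integral_mono_AE) (auto intro!: spectral_integral)
  also have "\<dots> = s * ((\<integral>x. x \<partial>?M) - E * (norm ?w)\<^sup>2)"
    by (simp add: spectral_integral total)
  finally show ?thesis
    by (simp add: total mult.commute flip: spectral_integral(2))
qed

lemma spectral_subspace_norm_le:
  assumes X: "X \<in> sets borel" and le: "\<And>x. x \<in> X \<Longrightarrow> \<epsilon> \<le> s * (x - E)" and s: "\<bar>s\<bar> = 1"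
  shows "\<epsilon> * norm (Q X u) \<le> norm (T u - E *\<^sub>R u)"
proof -
  let ?w = "Q X u"
  have "inner ?w (T u) = inner ?w (T ?w)"
    using spectral_subspace_reduces[OF X, of u u] linear_add[OF lin]
    by (subst pvm_Compl[OF X, of u]) (simp add: inner_add_right)
  moreover have "inner ?w u = (norm ?w)\<^sup>2"
    using pvm_norm_sq[OF X, of u] by (simp add: inner_commute)
  ultimately have "\<epsilon> * (norm ?w)\<^sup>2 \<le> s * inner ?w (T u - E *\<^sub>R u)"
    using quadratic_form_lower_bound[OF X le, of u] by (simp add: inner_diff_right)
  also have "\<dots> \<le> \<bar>s * inner ?w (T u - E *\<^sub>R u)\<bar>" by simp
  also have "\<dots> = \<bar>inner ?w (T u - E *\<^sub>R u)\<bar>" using s by (simp add: abs_mult)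
  also have "\<dots> \<le> norm ?w * norm (T u - E *\<^sub>R u)" by (rule Cauchy_Schwarz_ineq2)
  finally have "norm ?w * (\<epsilon> * norm ?w) \<le> norm ?w * norm (T u - E *\<^sub>R u)"
    by (simp add: power2_eq_square ac_simps)
  then show ?thesis by (cases "norm ?w = 0") auto
qed

text \<open>Outside \<open>I\<close> the spectral parameter stays at distance \<open>\<epsilon>\<close> from \<open>E\<close>. Above and below \<open>E\<close>
  separately, \<open>T - E\<close> has a definite sign, and the Cauchy-Schwarz inequality bounds the
  corresponding part of \<open>u\<close> by \<open>norm (T u - E *\<^sub>R u) / \<epsilon>\<close>.\<close>

lemma spectral_projection_approx:
  assumes I: "open I" "E \<in> I"
  obtains C where "\<And>u. norm (u - Q I u) \<le> C * norm (T u - E *\<^sub>R u)"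
proof -
  obtain \<epsilon> where \<epsilon>: "\<epsilon> > 0" "\<And>x. \<bar>x - E\<bar> < \<epsilon> \<Longrightarrow> x \<in> I"
    using I by (metis open_dist dist_real_def)
  define X Y where "X = - I \<inter> {E..}" and "Y = - I \<inter> {..<E}"
  have bor: "X \<in> sets borel" "Y \<in> sets borel" "I \<in> sets borel"
    using I by (auto simp: X_def Y_def)
  have "norm (u - Q I u) \<le> 2 / \<epsilon> * norm (T u - E *\<^sub>R u)" for u
  proof -
    have "\<epsilon> * norm (Q X u) \<le> norm (T u - E *\<^sub>R u)"
      using \<epsilon>(2) by (intro spectral_subspace_norm_le[where s = 1] bor) (force simp: X_def)+
    moreover have "\<epsilon> * norm (Q Y u) \<le> norm (T u - E *\<^sub>R u)"
      using \<epsilon>(2) by (intro spectral_subspace_norm_le[where s = "- 1"] bor) (force simp: Y_def)+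
    moreover have "u - Q I u = Q X u + Q Y u"
    proof -
      have "X \<union> Y = - I" "X \<inter> Y = {}" by (auto simp: X_def Y_def)
      then have "Q (- I) u = Q X u + Q Y u" using pvm_Un[OF bor(1,2)] by metis
      then show ?thesis using pvm_Compl[OF bor(3), of u] by (metis add_diff_cancel_left')
    qed
    ultimately have "\<epsilon> * norm (u - Q I u) \<le> 2 * norm (T u - E *\<^sub>R u)"
      using \<epsilon>(1) norm_triangle_ineq[of "Q X u" "Q Y u"]
      by (smt (verit, best) distrib_left mult_left_mono)
    then show ?thesis using \<epsilon>(1) by (simp add: field_simps)
  qed
  then show ?thesis by (rule that)
qed

end

end


section \<open>Plane waves cut off to large boxes\<close>

lemma card_box:
  assumes "\<And>i. finite (S i)"
  shows "finite {n :: 'b ^ 'd::finite. \<forall>i. n $ i \<in> S i}"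
    and "card {n :: 'b ^ 'd::finite. \<forall>i. n $ i \<in> S i} = (\<Prod>i\<in>UNIV. card (S i))"
proof -
  have b: "bij_betw (\<lambda>n. ($) n) {n :: 'b ^ 'd. \<forall>i. n $ i \<in> S i} (PiE UNIV S)"
    by (rule bij_betwI[where g = vec_lambda]) (auto simp: PiE_UNIV_domain)
  then show "card {n :: 'b ^ 'd. \<forall>i. n $ i \<in> S i} = (\<Prod>i\<in>UNIV. card (S i))"
    by (simp add: bij_betw_same_card card_PiE)
  show "finite {n :: 'b ^ 'd. \<forall>i. n $ i \<in> S i}"
    using b assms by (simp add: bij_betw_finite finite_PiE)
qed

text \<open>A shift along axis \<open>i\<close> multiplies the plane wave by a phase, except for the sites that enter or
  leave the box. These form two opposite faces with \<open>L ^ (d - 1)\<close> sites each, against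
  \<open>L ^ d\<close> sites of the box.\<close>

lemma boxed_plane_wave:
  fixes \<theta> :: "'d::finite \<Rightarrow> real" and L :: nat
  assumes L: "L \<ge> 1"
  obtains u :: "(int ^ 'd) ell2"
  where "u \<in> compact_support" "norm u = 1"
    "\<And>i. norm (shift i 1 u - cis (- \<theta> i) *\<^sub>C u) = sqrt (2 / real L)"
proof -
  let ?B = "{n :: int ^ 'd. \<forall>i. n $ i \<in> {0..<int L}}"
  define ph where "ph = (\<lambda>n :: int ^ 'd. cis (\<Sum>i\<in>UNIV. \<theta> i * of_int (n $ i)))"
  define z :: "(int ^ 'd) ell2" where "z = Abs_ell2 (\<lambda>n. of_bool (n \<in> ?B) * ph n)"
  have finB: "finite ?B" by (rule card_box) simp
  have cardB: "card ?B = L ^ CARD('d)"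
    unfolding card_box(2)[of "\<lambda>_ :: 'd. {0..<int L}", OF finite_atLeastLessThan_int] by simp
  have z: "seq z = (\<lambda>n. of_bool (n \<in> ?B) * ph n)"
  proof -
    have "(\<lambda>n. (cmod (of_bool (n \<in> ?B) * ph n))\<^sup>2) summable_on UNIV"
      by (rule finite_nonzero_values_imp_summable_on, rule finite_subset[OF _ finB]) auto
    then show ?thesis unfolding z_def by (simp add: Abs_ell2_inverse)
  qed
  have zc: "z \<in> compact_support"
    unfolding compact_support_def using finite_subset[OF _ finB] by (auto simp: z)
  have nz: "(norm z)\<^sup>2 = real L ^ CARD('d)"
    by (subst norm_ell2_finite_support[OF finB])
      (auto simp: z ph_def cardB[simplified] norm_mult)
  then have z0: "norm z > 0" using L by (metis norm_ge_zero not_one_le_zero of_nat_eq_0_iff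
        order_le_less power_eq_0_iff zero_eq_power2)
  have def: "(norm (shift i 1 z - cis (- \<theta> i) *\<^sub>C z))\<^sup>2 = 2 * real L ^ (CARD('d) - 1)" for i
  proof -
    let ?S = "\<lambda>l. if l = i then {0, int L} else {0..<int L}"
    let ?D = "{n :: int ^ 'd. \<forall>l. n $ l \<in> ?S l}"
    have mem: "(n - axis i 1 \<in> ?B) \<noteq> (n \<in> ?B) \<longleftrightarrow> n \<in> ?D" for n
    proof -
      have 1: "n - axis i 1 \<in> ?B \<longleftrightarrow> (\<forall>l. l \<noteq> i \<longrightarrow> n $ l \<in> {0..<int L}) \<and> n $ i - 1 \<in> {0..<int L}"
        by (auto simp: axis_def)
      have 2: "n \<in> ?B \<longleftrightarrow> (\<forall>l. l \<noteq> i \<longrightarrow> n $ l \<in> {0..<int L}) \<and> n $ i \<in> {0..<int L}"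
        by auto
      have 3: "n \<in> ?D \<longleftrightarrow> (\<forall>l. l \<noteq> i \<longrightarrow> n $ l \<in> {0..<int L}) \<and> n $ i \<in> {0, int L}"
        by auto
      have "(n $ i - 1 \<in> {0..<int L}) \<noteq> (n $ i \<in> {0..<int L}) \<longleftrightarrow> n $ i \<in> {0, int L}"
        using L by auto
      then show ?thesis unfolding 1 2 3 by blast
    qed
    have finD: "finite ?D" by (rule card_box) auto
    have "card ?D = (\<Prod>l\<in>UNIV. card (?S l))" by (rule card_box) auto
    also have "\<dots> = card (?S i) * (\<Prod>l\<in>UNIV - {i}. card (?S l))" by (rule prod.remove) auto
    also have "(\<Prod>l\<in>UNIV - {i}. card (?S l)) = (\<Prod>l\<in>UNIV - {i}. L)"
      by (rule prod.cong) auto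
    also have "\<dots> = L ^ (CARD('d) - 1)" by simp
    also have "card (?S i) = 2" using L by simp
    finally have cardD: "card ?D = 2 * L ^ (CARD('d) - 1)" .
    have ph: "ph (n - axis i 1) = cis (- \<theta> i) * ph n" for n
    proof -
      have "(\<Sum>l\<in>UNIV. \<theta> l * of_int ((n - axis i 1) $ l)) =
          (\<Sum>l\<in>UNIV. \<theta> l * of_int (n $ l)) - (\<Sum>l\<in>UNIV. if l = i then \<theta> i else 0)"
        unfolding sum_subtractf[symmetric]
        by (rule sum.cong) (auto simp: axis_def algebra_simps)
      then show ?thesis by (simp add: ph_def cis_mult)
    qed
    have val: "seq (shift i 1 z - cis (- \<theta> i) *\<^sub>C z) n =
        (of_bool (n - axis i 1 \<in> ?B) - of_bool (n \<in> ?B)) * (cis (- \<theta> i) * ph n)" for n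
      by (simp only: seq_simps seq_shift z ph) (simp add: algebra_simps)
    have sq: "(cmod (seq (shift i 1 z - cis (- \<theta> i) *\<^sub>C z) n))\<^sup>2 = of_bool (n \<in> ?D)" for n
      unfolding val mem[symmetric] norm_mult by (auto simp: ph_def)
    have "seq (shift i 1 z - cis (- \<theta> i) *\<^sub>C z) n = 0" if "n \<notin> ?D" for n
      using sq[of n] unfolding of_bool_def if_not_P[OF that] by simp
    then have "(norm (shift i 1 z - cis (- \<theta> i) *\<^sub>C z))\<^sup>2 =
        (\<Sum>n\<in>?D. (cmod (seq (shift i 1 z - cis (- \<theta> i) *\<^sub>C z) n))\<^sup>2)"
      by (rule norm_ell2_finite_support[OF finD])
    also have "\<dots> = (\<Sum>n\<in>?D. 1)"
      by (rule sum.cong[OF refl]) (simp only: sq of_bool_eq)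
    finally show ?thesis by (simp add: cardD)
  qed
  define u where "u = (1 / norm z) *\<^sub>R z"
  show ?thesis
  proof (rule that)
    show "u \<in> compact_support"
      using zc z0 by (simp add: u_def compact_support_def seq_simps)
    show "norm u = 1" using z0 by (simp add: u_def)
    show "norm (shift i 1 u - cis (- \<theta> i) *\<^sub>C u) = sqrt (2 / real L)" for i
    proof -
      have "shift i 1 u - cis (- \<theta> i) *\<^sub>C u = (1 / norm z) *\<^sub>R (shift i 1 z - cis (- \<theta> i) *\<^sub>C z)"
        by (rule ell2_eqI) (simp add: u_def seq_simps seq_shift algebra_simps)
      then have "(norm (shift i 1 u - cis (- \<theta> i) *\<^sub>C u))\<^sup>2
          = (norm (shift i 1 z - cis (- \<theta> i) *\<^sub>C z))\<^sup>2 / (norm z)\<^sup>2"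
        by (simp add: power_divide)
      also have "\<dots> = 2 / real L"
        unfolding def nz using L power_minus_mult[of "CARD('d)" "real L"] by (simp add: field_simps)
      finally show ?thesis by (simp add: real_sqrt_unique)
    qed
  qed
qed

text \<open>An approximate eigenvector of the unit shift is one of all its powers, since shifts are
  isometries: each further step adds the same defect.\<close>

lemma shift_defect_nat:
  "norm (shift i (int k) u - cis (- (real k * \<theta>)) *\<^sub>C u) \<le> real k * norm (shift i 1 u - cis (- \<theta>) *\<^sub>C u)"
proof (induction k)
  case 0
  have "1 *\<^sub>C u = u" by (rule ell2_eqI) (simp add: seq_simps)
  then show ?case by (simp add: shift_0)
next
  case (Suc k)
  have "shift i (int (Suc k)) u - cis (- (real (Suc k) * \<theta>)) *\<^sub>C u
    = shift i (int k) (shift i 1 u - cis (- \<theta>) *\<^sub>C u)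
      + cis (- \<theta>) *\<^sub>C (shift i (int k) u - cis (- (real k * \<theta>)) *\<^sub>C u)"
    by (rule ell2_eqI)
      (simp add: shift_diff shift_scaleC shift_shift seq_simps right_diff_distrib cis_mult
        add.commute distrib_right flip: mult.assoc)
  then have "norm (shift i (int (Suc k)) u - cis (- (real (Suc k) * \<theta>)) *\<^sub>C u)
    \<le> norm (shift i 1 u - cis (- \<theta>) *\<^sub>C u) + norm (shift i (int k) u - cis (- (real k * \<theta>)) *\<^sub>C u)"
    using norm_triangle_ineq[of "shift i (int k) (shift i 1 u - cis (- \<theta>) *\<^sub>C u)"
        "cis (- \<theta>) *\<^sub>C (shift i (int k) u - cis (- (real k * \<theta>)) *\<^sub>C u)"]
    by (simp only: norm_shift norm_scaleC norm_cis mult_1)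
  then show ?case using Suc by (simp add: distrib_right)
qed

lemma shift_defect:
  "norm (shift i k u - cis (- (real_of_int k * \<theta>)) *\<^sub>C u)
    \<le> real_of_int \<bar>k\<bar> * norm (shift i 1 u - cis (- \<theta>) *\<^sub>C u)"
proof (cases "k \<ge> 0")
  case True
  then show ?thesis using shift_defect_nat[of i "nat k" u \<theta>] by simp
next
  case False
  define m where "m = nat (- k)"
  have k: "k = - int m" using False by (simp add: m_def)
  \<comment> \<open>undoing the shift and the phase reduces a negative power to the positive one\<close>
  have "shift i k u - cis (- (real_of_int k * \<theta>)) *\<^sub>C u
    = - (cis (real m * \<theta>) *\<^sub>C shift i k (shift i (int m) u - cis (- (real m * \<theta>)) *\<^sub>C u))"
  proof -
    have "cis (real m * \<theta>) * (cis (- (real m * \<theta>)) * a) = a" for a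
      by (simp add: cis_mult flip: mult.assoc)
    then show ?thesis unfolding k
      by (intro ell2_eqI)
        (simp add: shift_diff shift_scaleC shift_shift shift_0 seq_simps uminus_ell2.rep_eq
          right_diff_distrib)
  qed
  then have "norm (shift i k u - cis (- (real_of_int k * \<theta>)) *\<^sub>C u)
      = norm (shift i (int m) u - cis (- (real m * \<theta>)) *\<^sub>C u)"
    by (simp only: norm_minus_cancel norm_scaleC norm_shift norm_cis mult_1)
  then show ?thesis using shift_defect_nat[of i m u \<theta>] by (simp add: k)
qed


section \<open>The Chebyshev form of the commutator symbol\<close>

lemma sin_mult_cheb_U: "sin t * poly (cheb_U n) (cos t) = sin (real (Suc n) * t)"
proof (induction n rule: cheb_U.induct)
  case 1 then show ?case by simp
next
  case 2 then show ?case by (simp add: sin_double)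
next
  case (3 n)
  have "sin (real (Suc (Suc (Suc n))) * t) =
      2 * cos t * sin (real (Suc (Suc n)) * t) - sin (real (Suc n) * t)"
  proof -
    have "sin (real (Suc (Suc (Suc n))) * t) = sin (real (Suc (Suc n)) * t + t)"
      "sin (real (Suc n) * t) = sin (real (Suc (Suc n)) * t - t)"
      by (simp_all add: algebra_simps)
    then show ?thesis by (simp only: sin_add sin_diff) (simp add: algebra_simps)
  qed
  then show ?case using 3 by (simp add: algebra_simps)
qed

lemma g_fun_cos:
  assumes "k \<ge> 1"
  shows "g_fun k (\<chi> i. cos (\<theta> i)) = (\<Sum>i\<in>UNIV. sin (\<theta> i) * sin (real k * \<theta> i))"
proof -
  have "(1 - (cos t)\<^sup>2) * poly (cheb_U (k - 1)) (cos t) = sin t * sin (real k * t)" for t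
  proof -
    have "1 - (cos t)\<^sup>2 = sin t * sin t"
      by (simp add: sin_squared_eq flip: power2_eq_square)
    then show ?thesis
      using sin_mult_cheb_U[of t "k - 1"] assms by (simp add: mult.assoc)
  qed
  then show ?thesis by (simp add: g_fun_def)
qed

lemma inner_shift_tendsto:
  assumes "\<And>L. norm (u L) = 1"
    and "((\<lambda>L. norm (shift i 1 (u L) - cis (- \<theta>) *\<^sub>C u L)) \<longlongrightarrow> 0) F"
  shows "((\<lambda>L. inner (u L) (shift i k (u L))) \<longlongrightarrow> cos (real_of_int k * \<theta>)) F"
proof (rule Lim_transform2, rule tendsto_const)
  show "((\<lambda>L. cos (real_of_int k * \<theta>) - inner (u L) (shift i k (u L))) \<longlongrightarrow> 0) F"
  proof (rule Lim_null_comparison)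
    show "((\<lambda>L. real_of_int \<bar>k\<bar> * norm (shift i 1 (u L) - cis (- \<theta>) *\<^sub>C u L)) \<longlongrightarrow> 0) F"
      using tendsto_mult_left[OF assms(2), of "real_of_int \<bar>k\<bar>"] by simp
    show "\<forall>\<^sub>F L in F. norm (cos (real_of_int k * \<theta>) - inner (u L) (shift i k (u L)))
      \<le> real_of_int \<bar>k\<bar> * norm (shift i 1 (u L) - cis (- \<theta>) *\<^sub>C u L)"
    proof (intro always_eventually allI)
      fix L
      have "cos (real_of_int k * \<theta>) - inner (u L) (shift i k (u L))
        = - inner (u L) (shift i k (u L) - cis (- (real_of_int k * \<theta>)) *\<^sub>C u L)"
        by (simp add: inner_diff_right inner_cis_scale assms)
      then have "norm (cos (real_of_int k * \<theta>) - inner (u L) (shift i k (u L)))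
        \<le> norm (u L) * norm (shift i k (u L) - cis (- (real_of_int k * \<theta>)) *\<^sub>C u L)"
        using Cauchy_Schwarz_ineq2 by (metis abs_minus_cancel real_norm_def)
      then show "norm (cos (real_of_int k * \<theta>) - inner (u L) (shift i k (u L)))
          \<le> real_of_int \<bar>k\<bar> * norm (shift i 1 (u L) - cis (- \<theta>) *\<^sub>C u L)"
        using shift_defect[of i k "u L" \<theta>] by (simp add: assms)
    qed
  qed
qed

lemma inner_dilation_commutator_tendsto:
  assumes k: "k \<ge> 1" and nu: "\<And>L. norm (u L) = 1"
    and lim: "\<And>i. ((\<lambda>L. norm (shift i 1 (u L) - cis (- \<theta> i) *\<^sub>C u L)) \<longlongrightarrow> 0) F"
  shows "((\<lambda>L. inner (u L) (dilation_commutator k (u L))) \<longlongrightarrow> g_fun k (\<chi> i. cos (\<theta> i))) F"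
proof -
  have "((\<lambda>L. \<Sum>i\<in>UNIV. 1 / 4 *
      (inner (u L) (shift i (int k - 1) (u L)) + inner (u L) (shift i (1 - int k) (u L))
       - inner (u L) (shift i (int k + 1) (u L)) - inner (u L) (shift i (- int k - 1) (u L))))
    \<longlongrightarrow> (\<Sum>i\<in>UNIV. 1 / 4 *
      (cos (real_of_int (int k - 1) * \<theta> i) + cos (real_of_int (1 - int k) * \<theta> i)
       - cos (real_of_int (int k + 1) * \<theta> i) - cos (real_of_int (- int k - 1) * \<theta> i)))) F"
    by (intro tendsto_intros inner_shift_tendsto nu lim)
  moreover have "1 / 4 *
      (cos (real_of_int (int k - 1) * t) + cos (real_of_int (1 - int k) * t)
       - cos (real_of_int (int k + 1) * t) - cos (real_of_int (- int k - 1) * t))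
     = sin t * sin (real k * t)" for t
  proof -
    have "cos (real_of_int (1 - int k) * t) = cos (t - real k * t)"
      "cos (real_of_int (- int k - 1) * t) = cos (- (real k * t) - t)"
      "cos (real_of_int (int k - 1) * t) = cos (real k * t - t)"
      "cos (real_of_int (int k + 1) * t) = cos (real k * t + t)"
      by (simp_all add: left_diff_distrib distrib_right)
    then show ?thesis
      by (simp only: cos_minus sin_minus cos_add cos_diff) (simp add: algebra_simps)
  qed
  ultimately show ?thesis
    by (simp add: dilation_commutator_def inner_sum_right inner_add_right inner_diff_right
        g_fun_cos[OF k])
qed

lemma abs_inner_dilation_commutator_le:
  fixes u :: "(int ^ 'd::finite) ell2"
  assumes "norm u = 1"
  shows "\<bar>inner u (dilation_commutator k u)\<bar> \<le> real CARD('d)"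
proof -
  have b: "\<bar>inner u (shift i m u)\<bar> \<le> 1" for i m
    using Cauchy_Schwarz_ineq2[of u "shift i m u"] assms by (simp add: norm_shift)
  have "\<bar>inner u (dilation_commutator k u)\<bar> \<le> (\<Sum>i\<in>(UNIV :: 'd set). 1)"
    unfolding dilation_commutator_def inner_sum_right
  proof (rule order_trans[OF sum_abs], rule sum_mono)
    fix i :: 'd
    show "\<bar>inner u ((1 / 4) *\<^sub>R (shift i (int k - 1) u + shift i (1 - int k) u
        - shift i (int k + 1) u - shift i (- int k - 1) u))\<bar> \<le> 1"
      using b[of i "int k - 1"] b[of i "1 - int k"] b[of i "int k + 1"] b[of i "- int k - 1"]
      by (simp add: inner_add_right inner_diff_right abs_le_iff)
  qed
  then show ?thesis by simp
qed

lemma norm_Laplacian_defect_le: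
  assumes "E = (\<Sum>i\<in>UNIV. cos (\<theta> i))"
  shows "norm (Laplacian u - E *\<^sub>R u) \<le> (\<Sum>i\<in>UNIV. norm (shift i 1 u - cis (- \<theta> i) *\<^sub>C u))"
proof -
  let ?r = "\<lambda>i k. shift i k u - cis (- (real_of_int k * \<theta> i)) *\<^sub>C u"
  have two_cos: "cis (- t) + cis t = 2 * of_real (cos t)" for t
    by (simp add: complex_eq_iff)
  have "Laplacian u - E *\<^sub>R u = (\<Sum>i\<in>UNIV. (1 / 2) *\<^sub>R (?r i 1 + ?r i (- 1)))"
  proof (rule ell2_eqI)
    fix n
    have "seq (Laplacian u - E *\<^sub>R u) n = (\<Sum>i\<in>UNIV. 1 / 2 *
        (seq u (n - axis i 1) + seq u (n - axis i (- 1))) - of_real (cos (\<theta> i)) * seq u n)"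
      by (simp add: Laplacian_def seq_simps seq_shift assms sum_subtractf sum_distrib_right)
    also have "\<dots> = (\<Sum>i\<in>UNIV. seq ((1 / 2) *\<^sub>R (?r i 1 + ?r i (- 1))) n)"
    proof (rule sum.cong[OF refl])
      fix i
      have "of_real (cos (\<theta> i)) * seq u n = 1 / 2 * ((cis (- \<theta> i) + cis (\<theta> i)) * seq u n)"
        unfolding two_cos by simp
      then show "1 / 2 * (seq u (n - axis i 1) + seq u (n - axis i (- 1)))
          - of_real (cos (\<theta> i)) * seq u n = seq ((1 / 2) *\<^sub>R (?r i 1 + ?r i (- 1))) n"
        by (simp add: seq_simps seq_shift field_simps)
    qed
    finally show "seq (Laplacian u - E *\<^sub>R u) n =
        seq (\<Sum>i\<in>UNIV. (1 / 2) *\<^sub>R (?r i 1 + ?r i (- 1))) n"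
      by (simp add: seq_sum)
  qed
  also have "norm \<dots> \<le> (\<Sum>i\<in>UNIV. norm (shift i 1 u - cis (- \<theta> i) *\<^sub>C u))"
  proof (rule sum_norm_le)
    fix i
    have "norm (?r i 1 + ?r i (- 1)) \<le> norm (?r i 1) + norm (?r i (- 1))"
      by (rule norm_triangle_ineq)
    then show "norm ((1 / 2) *\<^sub>R (?r i 1 + ?r i (- 1))) \<le> norm (shift i 1 u - cis (- \<theta> i) *\<^sub>C u)"
      using shift_defect[of i "- 1" u "\<theta> i"] by simp
  qed
  finally show ?thesis .
qed


section \<open>Mourre estimates force positivity on the energy surface\<close>

text \<open>Uniformity in \<open>j\<close> comes from \<open>abs_inner_dilation_commutator_le\<close>, which makes \<open>\<bar>\<rho>\<^sub>j\<bar> d\<close> a summable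
  majorant; the limit along the boxed plane waves may therefore be taken term by term.\<close>

lemma Mourre_estimate_pointwise:
  fixes x :: "real ^ 'd::finite" and \<rho> :: "nat \<Rightarrow> real" and \<kappa> :: nat
    and B P :: "(int ^ 'd) ell2 \<Rightarrow> (int ^ 'd) ell2"
  assumes \<kappa>: "\<kappa> \<ge> 1"
    and dom: "(compact_support :: (int ^ 'd) ell2 set)
      \<subseteq> Domain (series_graph \<rho> (\<lambda>j. dilation j \<kappa>))"
    and B: "is_commutator (closure (series_graph \<rho> (\<lambda>j. dilation j \<kappa>))) B"
    and I: "open I" "E \<in> I" and P: "is_spectral_projection Laplacian I P"
    and est: "op_le (\<lambda>u. \<gamma> *\<^sub>R P u) (\<lambda>u. P (B (P u)))"
    and x: "x \<in> energy_surface E"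
  shows "summable (\<lambda>j. \<rho> (Suc j) * g_fun (Suc j * \<kappa>) x)"
    and "\<gamma> \<le> (\<Sum>j. \<rho> (Suc j) * g_fun (Suc j * \<kappa>) x)"
proof -
  define \<theta> where "\<theta> i = arccos (x $ i)" for i
  have cos\<theta>: "cos (\<theta> i) = x $ i" for i
    using x by (simp add: \<theta>_def energy_surface_def cos_arccos)
  then have x_eq: "(\<chi> i. cos (\<theta> i)) = x" and E: "E = (\<Sum>i\<in>UNIV. cos (\<theta> i))"
    using x by (simp_all add: vec_eq_iff energy_surface_def)
  have "\<exists>u :: (int ^ 'd) ell2. u \<in> compact_support \<and> norm u = 1 \<and>
      (\<forall>i. norm (shift i 1 u - cis (- \<theta> i) *\<^sub>C u) = sqrt (2 / real (Suc L)))" for L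
    by (rule boxed_plane_wave[of "Suc L" \<theta>]) auto
  then obtain u :: "nat \<Rightarrow> (int ^ 'd) ell2"
    where uc: "\<And>L. u L \<in> compact_support" and nu: "\<And>L. norm (u L) = 1"
      and defect: "\<And>L i. norm (shift i 1 (u L) - cis (- \<theta> i) *\<^sub>C u L) = sqrt (2 / real (Suc L))"
    by metis
  have "(\<lambda>L. sqrt (2 / real (Suc L))) \<longlonglongrightarrow> sqrt 0"
    by (intro tendsto_real_sqrt LIMSEQ_Suc lim_const_over_n)
  then have lim: "(\<lambda>L. norm (shift i 1 (u L) - cis (- \<theta> i) *\<^sub>C u L)) \<longlonglongrightarrow> 0" for i
    by (simp add: defect)
  have Suck: "Suc j * \<kappa> \<ge> 1" for j using \<kappa> by simp

  let ?a = "\<lambda>j L. \<rho> (Suc j) * inner (u L) (dilation_commutator (Suc j * \<kappa>) (u L))"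
  have "(\<forall>\<^sub>F L in sequentially. summable (\<lambda>j. norm (?a j L))) \<and>
      summable (\<lambda>j. norm (\<rho> (Suc j) * g_fun (Suc j * \<kappa>) x)) \<and>
      (\<lambda>L. \<Sum>j. ?a j L) \<longlonglongrightarrow> (\<Sum>j. \<rho> (Suc j) * g_fun (Suc j * \<kappa>) x)"
  proof (rule tannerys_theorem)
    show "(\<lambda>L. ?a j L) \<longlonglongrightarrow> \<rho> (Suc j) * g_fun (Suc j * \<kappa>) x" for j
      using inner_dilation_commutator_tendsto[OF Suck nu lim] by (intro tendsto_mult_left) (simp add: x_eq)
    show "\<forall>\<^sub>F (j, L) in at_top \<times>\<^sub>F sequentially. norm (?a j L) \<le> \<bar>\<rho> (Suc j)\<bar> * real CARD('d)"
      by (intro always_eventually) (auto simp: abs_mult intro!: mult_left_mono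
          abs_inner_dilation_commutator_le nu)
    show "summable (\<lambda>j. \<bar>\<rho> (Suc j)\<bar> * real CARD('d))"
      by (intro summable_mult2 coefficients_summable[OF dom \<kappa>])
  qed simp
  then have summ: "summable (\<lambda>j. norm (\<rho> (Suc j) * g_fun (Suc j * \<kappa>) x))"
    and "(\<lambda>L. \<Sum>j. ?a j L) \<longlonglongrightarrow> (\<Sum>j. \<rho> (Suc j) * g_fun (Suc j * \<kappa>) x)" by auto
  moreover have "(\<Sum>j. ?a j L) = inner (u L) (B (u L))" for L
    using inner_commutator_sums[OF B dom uc] by (simp add: sums_iff)
  ultimately have limB: "(\<lambda>L. inner (u L) (B (u L))) \<longlonglongrightarrow> (\<Sum>j. \<rho> (Suc j) * g_fun (Suc j * \<kappa>) x)"
    by simp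
  show "summable (\<lambda>j. \<rho> (Suc j) * g_fun (Suc j * \<kappa>) x)"
    using summ by (rule summable_norm_cancel)

  obtain Q where Q: "spectral_measure Laplacian Q" and PQ: "P = Q I"
    using P by (auto simp: is_spectral_projection_def)
  have pvm: "projection_valued_measure Q" using Q by (simp add: spectral_measure_def)
  have linL: "linear (Laplacian :: (int ^ 'd) ell2 \<Rightarrow> _)"
    by (rule linearI; rule ell2_eqI)
      (simp_all add: Laplacian_def seq_simps seq_shift algebra_simps sum.distrib sum_distrib_left)
  obtain C where C: "\<And>u. norm (u - P u) \<le> C * norm (Laplacian u - E *\<^sub>R u)"
    unfolding PQ
    by (rule spectral_projection_approx[OF pvm Q linL inner_Laplacian I]) blast
  have blB: "bounded_linear B" using B by (simp add: is_commutator_def bounded_op_def)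
  have limE: "(\<lambda>L. norm (Laplacian (u L) - E *\<^sub>R u L)) \<longlonglongrightarrow> 0"
  proof (rule Lim_null_comparison)
    show "\<forall>\<^sub>F L in sequentially. norm (norm (Laplacian (u L) - E *\<^sub>R u L))
        \<le> (\<Sum>i\<in>UNIV. norm (shift i 1 (u L) - cis (- \<theta> i) *\<^sub>C u L))"
      using norm_Laplacian_defect_le[OF E] by (intro always_eventually) simp
    show "(\<lambda>L. \<Sum>i\<in>UNIV. norm (shift i 1 (u L) - cis (- \<theta> i) *\<^sub>C u L)) \<longlonglongrightarrow> 0"
      by (intro tendsto_null_sum lim)
  qed
  have limP: "(\<lambda>L. u L - P (u L)) \<longlonglongrightarrow> 0"
  proof (rule Lim_null_comparison)
    show "\<forall>\<^sub>F L in sequentially. norm (u L - P (u L)) \<le> C * norm (Laplacian (u L) - E *\<^sub>R u L)"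
      using C by (intro always_eventually) simp
    show "(\<lambda>L. C * norm (Laplacian (u L) - E *\<^sub>R u L)) \<longlonglongrightarrow> 0"
      using tendsto_mult_left[OF limE, of C] by simp
  qed
  have Isets: "I \<in> sets borel" using I by simp
  have low: "\<gamma> * (norm (P v))\<^sup>2 \<le> inner (P v) (B (P v))" for v
  proof -
    have "0 \<le> inner v (P (B (P v)) - \<gamma> *\<^sub>R P v)"
      using est by (auto simp: op_le_def inner_ell2_def complex_nonneg_Reals_iff)
    then show ?thesis
      using pvm_inner[OF pvm Isets] pvm_norm_sq[OF pvm Isets, of v]
      by (simp add: inner_diff_right PQ)
  qed
  have diff: "inner (P v) (B (P v)) = inner v (B v) - inner (v - P v) (B v) - inner (P v) (B (v - P v))" for v
    by (simp add: linear_diff[OF bounded_linear.linear[OF blB]] inner_diff_left inner_diff_right)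
  obtain K where K: "\<And>v. norm (B v) \<le> norm v * K"
    using bounded_linear.bounded[OF blB] by blast
  have Pcontr: "norm (P v) \<le> norm v" for v
  proof -
    have "(norm (P v))\<^sup>2 \<le> norm v * norm (P v)"
      using norm_cauchy_schwarz[of v "P v"] pvm_norm_sq[OF pvm Isets, of v] by (simp add: PQ)
    then show ?thesis by (cases "norm (P v) = 0") (auto simp: power2_eq_square)
  qed
  \<comment> \<open>replacing \<open>u\<^sub>L\<close> by its projection does not change the limit of the quadratic form\<close>
  have e1: "(\<lambda>L. inner (u L - P (u L)) (B (u L))) \<longlonglongrightarrow> 0"
  proof (rule Lim_null_comparison)
    show "\<forall>\<^sub>F L in sequentially. norm (inner (u L - P (u L)) (B (u L))) \<le> norm (u L - P (u L)) * K"
    proof (intro always_eventually allI)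
      fix L
      have "\<bar>inner (u L - P (u L)) (B (u L))\<bar> \<le> norm (u L - P (u L)) * norm (B (u L))"
        by (rule Cauchy_Schwarz_ineq2)
      also have "\<dots> \<le> norm (u L - P (u L)) * K"
        using K[of "u L"] by (intro mult_left_mono) (auto simp: nu)
      finally show "norm (inner (u L - P (u L)) (B (u L))) \<le> norm (u L - P (u L)) * K" by simp
    qed
    show "(\<lambda>L. norm (u L - P (u L)) * K) \<longlonglongrightarrow> 0"
      using tendsto_mult_right[OF tendsto_norm_zero[OF limP], of K] by simp
  qed
  have e2: "(\<lambda>L. inner (P (u L)) (B (u L - P (u L)))) \<longlonglongrightarrow> 0"
  proof (rule Lim_null_comparison)
    show "\<forall>\<^sub>F L in sequentially. norm (inner (P (u L)) (B (u L - P (u L)))) \<le> norm (B (u L - P (u L)))"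
    proof (intro always_eventually allI)
      fix L
      have "\<bar>inner (P (u L)) (B (u L - P (u L)))\<bar> \<le> norm (P (u L)) * norm (B (u L - P (u L)))"
        by (rule Cauchy_Schwarz_ineq2)
      also have "\<dots> \<le> 1 * norm (B (u L - P (u L)))"
        using Pcontr[of "u L"] by (intro mult_right_mono) (auto simp: nu)
      finally show "norm (inner (P (u L)) (B (u L - P (u L)))) \<le> norm (B (u L - P (u L)))" by simp
    qed
    show "(\<lambda>L. norm (B (u L - P (u L)))) \<longlonglongrightarrow> 0"
      by (intro tendsto_norm_zero bounded_linear.tendsto_zero[OF blB] limP)
  qed
  have "(\<lambda>L. inner (P (u L)) (B (P (u L)))) \<longlonglongrightarrow> (\<Sum>j. \<rho> (Suc j) * g_fun (Suc j * \<kappa>) x) - 0 - 0"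
    unfolding diff by (intro tendsto_diff limB e1 e2)
  moreover have "(\<lambda>L. \<gamma> * (norm (P (u L)))\<^sup>2) \<longlonglongrightarrow> \<gamma> * 1"
  proof (intro tendsto_mult_left)
    have "(norm (P v))\<^sup>2 = (norm v)\<^sup>2 - inner v (v - P v)" for v
      using pvm_norm_sq[OF pvm Isets, of v]
      by (simp add: inner_diff_right PQ power2_norm_eq_inner)
    then have eq: "(norm (P (u L)))\<^sup>2 = 1 - inner (u L) (u L - P (u L))" for L
      by (simp add: nu)
    have "(\<lambda>L. inner (u L) (u L - P (u L))) \<longlonglongrightarrow> 0"
      by (rule Lim_null_comparison[OF _ tendsto_norm_zero[OF limP]], intro always_eventually)
        (use Cauchy_Schwarz_ineq2[of "u _"] in \<open>simp add: nu\<close>)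
    then have "(\<lambda>L. 1 - inner (u L) (u L - P (u L))) \<longlonglongrightarrow> 1 - 0"
      by (intro tendsto_diff tendsto_const)
    then show "(\<lambda>L. (norm (P (u L)))\<^sup>2) \<longlonglongrightarrow> 1" by (simp add: eq)
  qed
  ultimately show "\<gamma> \<le> (\<Sum>j. \<rho> (Suc j) * g_fun (Suc j * \<kappa>) x)"
    using LIMSEQ_le[of "\<lambda>L. \<gamma> * (norm (P (u L)))\<^sup>2"] low by force
qed

lemma Threshold_level_disjoint_Mourre_set:
  assumes \<kappa>: "\<kappa> \<ge> 1"
    and level: "E \<in> Threshold_level TYPE('d::finite) m \<kappa>"
    and mourre: "E \<in> Mourre_set TYPE('d) \<kappa>"
  shows False
proof -
  obtain x :: "nat \<Rightarrow> real ^ 'd" and \<omega> :: "nat \<Rightarrow> real"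
    where x: "\<And>q. q \<le> m \<Longrightarrow> x q \<in> energy_surface E" and \<omega>: "\<And>q. q < m \<Longrightarrow> \<omega> q \<le> 0"
      and g: "\<And>j. j \<ge> 1 \<Longrightarrow> g_fun (j * \<kappa>) (x m) = (\<Sum>q<m. \<omega> q * g_fun (j * \<kappa>) (x q))"
    using level by (auto simp: Threshold_level_def)
  obtain A :: "(int ^ 'd) graph" and B I P \<gamma>
    where A: "conjugate_op \<kappa> A" and B: "is_commutator A B" and I: "open I" "E \<in> I"
      and P: "is_spectral_projection Laplacian I P" and \<gamma>: "\<gamma> > 0"
      and est: "op_le (\<lambda>u. \<gamma> *\<^sub>R P u) (\<lambda>u. P (B (P u)))"
    using mourre unfolding Mourre_set_def by blast
  obtain \<rho> where dom: "(compact_support :: (int ^ 'd) ell2 set)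
      \<subseteq> Domain (series_graph \<rho> (\<lambda>j. dilation j \<kappa>))"
    and "A = closure (series_graph \<rho> (\<lambda>j. dilation j \<kappa>))"
    using A unfolding conjugate_op_def by blast
  with B have B: "is_commutator (closure (series_graph \<rho> (\<lambda>j. dilation j \<kappa>))) B" by simp
  let ?G = "\<lambda>y :: real ^ 'd. \<Sum>j. \<rho> (Suc j) * g_fun (Suc j * \<kappa>) y"
  note sym = Mourre_estimate_pointwise[OF \<kappa> dom B I P est]
  have summ: "summable (\<lambda>j. \<rho> (Suc j) * g_fun (Suc j * \<kappa>) (x q))" if "q \<le> m" for q
    using sym(1)[OF x[OF that]] .
  have pos: "?G (x q) \<ge> \<gamma>" if "q \<le> m" for q
    using sym(2)[OF x[OF that]] .
  have "\<rho> (Suc j) * g_fun (Suc j * \<kappa>) (x m)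
      = (\<Sum>q<m. \<omega> q * (\<rho> (Suc j) * g_fun (Suc j * \<kappa>) (x q)))" for j
    by (subst g) (simp_all add: sum_distrib_left mult.left_commute del: mult_Suc)
  then have "?G (x m) = (\<Sum>j. \<Sum>q<m. \<omega> q * (\<rho> (Suc j) * g_fun (Suc j * \<kappa>) (x q)))"
    by simp
  also have "\<dots> = (\<Sum>q<m. \<omega> q * ?G (x q))"
    using summ by (subst suminf_sum) (auto intro!: summable_mult simp: suminf_mult)
  also have "\<dots> \<le> 0"
  proof (intro sum_nonpos mult_nonpos_nonneg)
    fix q assume "q \<in> {..<m}"
    then show "\<omega> q \<le> 0" "0 \<le> ?G (x q)" using \<omega>[of q] pos[of q] \<gamma> by auto
  qed
  finally show False using pos[of m] \<gamma> by simp
qed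

theorem lemma1p2:
  fixes \<kappa> \<alpha> m :: nat
  assumes "\<kappa> \<ge> 1" and "\<alpha> \<ge> 1"
  shows "Threshold_level TYPE('d::finite) m \<kappa> \<subseteq> Threshold_level TYPE('d) m (\<alpha> * \<kappa>) \<and>
         Threshold_level TYPE('d) m (\<alpha> * \<kappa>) \<subseteq> Threshold TYPE('d) (\<alpha> * \<kappa>)"
proof
  show "Threshold_level TYPE('d) m \<kappa> \<subseteq> Threshold_level TYPE('d) m (\<alpha> * \<kappa>)"
  proof
    fix E assume "E \<in> Threshold_level TYPE('d) m \<kappa>"
    then obtain x :: "nat \<Rightarrow> real ^ 'd" and \<omega> :: "nat \<Rightarrow> real"
      where E: "E \<in> spec_Laplacian TYPE('d)" "\<forall>q\<le>m. x q \<in> energy_surface E" "\<forall>q<m. \<omega> q \<le> 0"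
        and g: "\<And>j. j \<ge> 1 \<Longrightarrow> g_fun (j * \<kappa>) (x m) = (\<Sum>q<m. \<omega> q * g_fun (j * \<kappa>) (x q))"
      by (auto simp: Threshold_level_def)
    have "g_fun (j * (\<alpha> * \<kappa>)) (x m) = (\<Sum>q<m. \<omega> q * g_fun (j * (\<alpha> * \<kappa>)) (x q))" if "j \<ge> 1" for j
      using g[of "j * \<alpha>"] that \<open>\<alpha> \<ge> 1\<close> by (simp add: mult.assoc)
    with E show "E \<in> Threshold_level TYPE('d) m (\<alpha> * \<kappa>)"
      unfolding Threshold_level_def by blast
  qed
next
  have "\<alpha> * \<kappa> \<ge> 1" using assms by simp
  then show "Threshold_level TYPE('d) m (\<alpha> * \<kappa>) \<subseteq> Threshold TYPE('d) (\<alpha> * \<kappa>)"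
    using Threshold_level_disjoint_Mourre_set[of "\<alpha> * \<kappa>" _ m, where 'd = 'd]
    by (auto simp: Threshold_def Threshold_level_def)
qed

end
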